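(* Let $I$ be a non-empty totally ordered set and let $A$ be a Banach algebra such that $\Delta(A)\neq\emptyset$. Then $UP(I,A)$ is amenable if and only if $I$ is a singleton and $A$ is amenable.
   Context: $\Delta(A)$ denotes the character space of a Banach algebra $A$, i.e. the set of all non-zero multiplicative linear functionals on $A$. For a Banach algebra $A$ and a non-empty totally ordered set $I$, $UP(I,A)$ is the set of all $I\times I$ upper triangular matrices $(a_{i,j})_{i,j\in I}$ with entries in $A$ (so $a_{i,j}=0$ unless $i\le j$) such that $\|(a_{i,j})\|=\sum_{i,j\in I}\|a_{i,j}\|<\infty$. With the usual matrix operations and this norm, $UP(I,A)$ is a Banach algebra. A Banach algebra $B$ is amenable if for every Banach $B$-bimodule $X$, every continuous derivation $D:B\to X^*$ is inner, i.e. there exists $x_0\in X^*$ with $D(a)=a\cdot x_0-x_0\cdot a$ for all $a\in B$. *)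

theory Defs
  imports "HOL-Analysis.Analysis"
begin

class complex_banach_algebra = real_normed_algebra + banach +
  fixes scaleC :: "complex \<Rightarrow> 'a \<Rightarrow> 'a"
  assumes scaleC_add_right: "scaleC c (x + y) = scaleC c x + scaleC c y"
    and scaleC_add_left: "scaleC (c + d) x = scaleC c x + scaleC d x"
    and scaleC_scaleC: "scaleC c (scaleC d x) = scaleC (c * d) x"
    and scaleC_of_real: "scaleC (complex_of_real r) x = scaleR r x"
    and scaleC_mult_left: "scaleC c x * y = scaleC c (x * y)"
    and scaleC_mult_right: "x * scaleC c y = scaleC c (x * y)"
    and norm_scaleC: "norm (scaleC c x) = cmod c * norm x"

definition character_space :: "('a::complex_banach_algebra \<Rightarrow> complex) set" where
  "character_space = {\<phi>. (\<forall>x y. \<phi> (x + y) = \<phi> x + \<phi> y) \<and> (\<forall>c x. \<phi> (scaleC c x) = c * \<phi> x) \<and>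
     (\<forall>x y. \<phi> (x * y) = \<phi> x * \<phi> y) \<and> (\<exists>x. \<phi> x \<noteq> 0)}"

text \<open>The index set is the (automatically non-empty) type \<open>'i\<close> of class \<open>linorder\<close>.\<close>

typedef (overloaded) ('i, 'a) up =
  "{a :: 'i::linorder \<Rightarrow> 'i \<Rightarrow> 'a::complex_banach_algebra.
     (\<forall>i j. \<not> i \<le> j \<longrightarrow> a i j = 0) \<and> (\<lambda>(i, j). norm (a i j)) summable_on UNIV}"
  morphisms entry Abs_up
  by (rule exI[of _ "\<lambda>_ _. 0"]) (simp add: case_prod_unfold)

setup_lifting type_definition_up

lemma entry_summable: "(\<lambda>(i, j). norm (entry a i j)) summable_on UNIV"
  using entry[of a] by auto

lemma entry_zero: "\<not> i \<le> j \<Longrightarrow> entry a i j = 0"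
  using entry[of a] by auto

lemma up_eqI: "(\<And>i j. entry a i j = entry b i j) \<Longrightarrow> a = b"
  by (meson entry_inject ext)

lemma up_product_triple:
  fixes a b :: "('i::linorder, 'a::complex_banach_algebra) up"
  shows "(\<lambda>((i, j), k). norm (entry a i k) * norm (entry b k j)) summable_on UNIV"
    and "(\<Sum>\<^sub>\<infinity>((i, j), k)\<in>UNIV. norm (entry a i k) * norm (entry b k j)) \<le>
      (\<Sum>\<^sub>\<infinity>(i, j)\<in>UNIV. norm (entry a i j)) * (\<Sum>\<^sub>\<infinity>(i, j)\<in>UNIV. norm (entry b i j))"
proof -
  define f where "f = (\<lambda>p. norm (entry a (fst p) (snd p)))"
  define g where "g = (\<lambda>p. norm (entry b (fst p) (snd p)))"
  have f: "f summable_on UNIV" and g: "g summable_on UNIV"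
    using entry_summable[of a] entry_summable[of b] by (simp_all add: f_def g_def case_prod_unfold)
  have fg: "(\<lambda>(p, q). f p * g q) summable_on UNIV \<times> UNIV"
  proof (rule summable_on_SigmaI)
    show "((\<lambda>q. case (p, q) of (p, q) \<Rightarrow> f p * g q) has_sum f p * infsum g UNIV) UNIV" for p
      using has_sum_cmult_right[OF has_sum_infsum[OF g]] by simp
    show "(\<lambda>p. f p * infsum g UNIV) summable_on UNIV"
      by (rule summable_on_cmult_left[OF f])
  qed (auto simp: f_def g_def)
  have fg_sum: "infsum (\<lambda>(p, q). f p * g q) (UNIV \<times> UNIV) = infsum f UNIV * infsum g UNIV"
    using infsum_Sigma'_banach[OF fg] infsum_cmult_right[of _ g] infsum_cmult_left[of _ f] f g by simp
  define h :: "('i \<times> 'i) \<times> 'i \<Rightarrow> ('i \<times> 'i) \<times> ('i \<times> 'i)" where "h = (\<lambda>((i, j), k). ((i, k), (k, j)))"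
  have h: "inj h" by (auto simp: h_def inj_on_def)
  have e: "(\<lambda>((i, j), k). norm (entry a i k) * norm (entry b k j)) = (\<lambda>(p, q). f p * g q) \<circ> h"
    by (auto simp: h_def f_def g_def)
  have s: "(\<lambda>(p, q). f p * g q) summable_on range h"
    using fg by (rule summable_on_subset_banach) auto
  show "(\<lambda>((i, j), k). norm (entry a i k) * norm (entry b k j)) summable_on UNIV"
    unfolding e using s summable_on_reindex[OF h] by blast
  have "(\<Sum>\<^sub>\<infinity>((i, j), k)\<in>UNIV. norm (entry a i k) * norm (entry b k j)) = infsum (\<lambda>(p, q). f p * g q) (range h)"
    unfolding e infsum_reindex[OF h] ..
  also have "\<dots> \<le> infsum (\<lambda>(p, q). f p * g q) (UNIV \<times> UNIV)"
    by (rule infsum_mono2[OF s fg]) (auto simp: f_def g_def)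
  also note fg_sum
  finally show "(\<Sum>\<^sub>\<infinity>((i, j), k)\<in>UNIV. norm (entry a i k) * norm (entry b k j)) \<le>
      (\<Sum>\<^sub>\<infinity>(i, j)\<in>UNIV. norm (entry a i j)) * (\<Sum>\<^sub>\<infinity>(i, j)\<in>UNIV. norm (entry b i j))"
    by (simp add: f_def g_def case_prod_unfold)
qed

lemma up_product_abs_summable: "(\<lambda>k. norm (entry a i k * entry b k j)) summable_on UNIV"
proof -
  have "(\<lambda>((i, j), k). norm (entry a i k) * norm (entry b k j)) summable_on range (\<lambda>k. ((i, j), k))"
    by (rule summable_on_subset_banach[OF up_product_triple(1)]) auto
  then have "(\<lambda>k. norm (entry a i k) * norm (entry b k j)) summable_on UNIV"
    by (subst (asm) summable_on_reindex) (auto simp: inj_on_def o_def)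
  then show ?thesis
    by (rule summable_on_comparison_test) (auto intro: norm_mult_ineq)
qed

lemma up_product_norms:
  "(\<lambda>(i, j). norm (\<Sum>\<^sub>\<infinity>k. entry a i k * entry b k j)) summable_on UNIV"
  "(\<Sum>\<^sub>\<infinity>(i, j)\<in>UNIV. norm (\<Sum>\<^sub>\<infinity>k. entry a i k * entry b k j)) \<le>
      (\<Sum>\<^sub>\<infinity>(i, j)\<in>UNIV. norm (entry a i j)) * (\<Sum>\<^sub>\<infinity>(i, j)\<in>UNIV. norm (entry b i j))"
proof -
  define t where "t = (\<lambda>(p, k). norm (entry a (fst p) k) * norm (entry b k (snd p)))"
  have t_eq: "t = (\<lambda>((i, j), k). norm (entry a i k) * norm (entry b k j))"
    by (auto simp: t_def)
  have t: "t summable_on UNIV \<times> UNIV"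
    using up_product_triple(1)[of a b] by (simp add: t_eq)
  have t1: "(\<lambda>p. \<Sum>\<^sub>\<infinity>k. t (p, k)) summable_on UNIV"
    using summable_on_Sigma_banach[of "\<lambda>p k. t (p, k)" UNIV "\<lambda>_. UNIV"] t by simp
  have t2: "(\<lambda>k. t (p, k)) summable_on UNIV" for p
  proof -
    have "t summable_on range (Pair p)" by (rule summable_on_subset_banach[OF t]) auto
    then show ?thesis by (subst (asm) summable_on_reindex) (auto simp: inj_on_def o_def)
  qed
  have le: "norm (\<Sum>\<^sub>\<infinity>k. entry a i k * entry b k j) \<le> (\<Sum>\<^sub>\<infinity>k. t ((i, j), k))" for i j
  proof -
    have "norm (\<Sum>\<^sub>\<infinity>k. entry a i k * entry b k j) \<le> (\<Sum>\<^sub>\<infinity>k. norm (entry a i k * entry b k j))"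
      by (rule norm_infsum_bound[OF up_product_abs_summable])
    also have "\<dots> \<le> (\<Sum>\<^sub>\<infinity>k. t ((i, j), k))"
      by (rule infsum_mono[OF up_product_abs_summable t2]) (auto simp: t_def intro: norm_mult_ineq)
    finally show ?thesis .
  qed
  show s: "(\<lambda>(i, j). norm (\<Sum>\<^sub>\<infinity>k. entry a i k * entry b k j)) summable_on UNIV"
    by (rule summable_on_comparison_test[OF t1]) (auto intro: le)
  have "(\<Sum>\<^sub>\<infinity>(i, j)\<in>UNIV. norm (\<Sum>\<^sub>\<infinity>k. entry a i k * entry b k j)) \<le> (\<Sum>\<^sub>\<infinity>p. \<Sum>\<^sub>\<infinity>k. t (p, k))"
    by (rule infsum_mono[OF s t1]) (auto intro: le)
  also have "\<dots> = infsum t UNIV"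
    using infsum_Sigma_banach[OF t] by simp
  also have "\<dots> \<le> (\<Sum>\<^sub>\<infinity>(i, j)\<in>UNIV. norm (entry a i j)) * (\<Sum>\<^sub>\<infinity>(i, j)\<in>UNIV. norm (entry b i j))"
    unfolding t_eq by (rule up_product_triple(2))
  finally show "(\<Sum>\<^sub>\<infinity>(i, j)\<in>UNIV. norm (\<Sum>\<^sub>\<infinity>k. entry a i k * entry b k j)) \<le>
      (\<Sum>\<^sub>\<infinity>(i, j)\<in>UNIV. norm (entry a i j)) * (\<Sum>\<^sub>\<infinity>(i, j)\<in>UNIV. norm (entry b i j))" .
qed

lemma summable_norm_add:
  fixes f g :: "'i \<Rightarrow> 'i \<Rightarrow> 'a::real_normed_vector"
  assumes "(\<lambda>(i, j). norm (f i j)) summable_on UNIV" "(\<lambda>(i, j). norm (g i j)) summable_on UNIV"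
  shows "(\<lambda>(i, j). norm (f i j + g i j)) summable_on UNIV"
  by (rule summable_on_comparison_test[OF summable_on_add[OF assms]]) (auto intro: norm_triangle_ineq)

lemma summable_norm_cmult:
  fixes f g :: "'i \<Rightarrow> 'i \<Rightarrow> 'a::real_normed_vector"
  assumes "(\<lambda>(i, j). norm (f i j)) summable_on UNIV" "\<And>i j. norm (g i j) = c * norm (f i j)"
  shows "(\<lambda>(i, j). norm (g i j)) summable_on UNIV"
    "(\<Sum>\<^sub>\<infinity>(i, j)\<in>UNIV. norm (g i j)) = c * (\<Sum>\<^sub>\<infinity>(i, j)\<in>UNIV. norm (f i j))"
  using summable_on_cmult_right[OF assms(1), of c] infsum_cmult_right[of c, OF assms(1)]
  by (simp_all add: case_prod_unfold assms(2))

lemma scaleC_zero [simp]: "scaleC c (0::'a::complex_banach_algebra) = 0"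
  using scaleC_add_right[of c "0::'a" 0] by simp

instantiation up :: (linorder, complex_banach_algebra) real_normed_algebra
begin

lift_definition zero_up :: "('a, 'b) up" is "\<lambda>_ _. 0" by (simp add: case_prod_unfold)

lift_definition plus_up :: "('a, 'b) up \<Rightarrow> ('a, 'b) up \<Rightarrow> ('a, 'b) up"
  is "\<lambda>a b i j. a i j + b i j" by (auto intro: summable_norm_add)

lift_definition uminus_up :: "('a, 'b) up \<Rightarrow> ('a, 'b) up" is "\<lambda>a i j. - a i j" by auto

definition minus_up :: "('a, 'b) up \<Rightarrow> ('a, 'b) up \<Rightarrow> ('a, 'b) up"
  where "minus_up a b = a + (- b)"

lift_definition times_up :: "('a, 'b) up \<Rightarrow> ('a, 'b) up \<Rightarrow> ('a, 'b) up"
  is "\<lambda>a b i j. \<Sum>\<^sub>\<infinity>k. a i k * b k j"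
proof -
  let ?U = "{a :: 'a \<Rightarrow> 'a \<Rightarrow> 'b. (\<forall>i j. \<not> i \<le> j \<longrightarrow> a i j = 0) \<and> (\<lambda>(i, j). norm (a i j)) summable_on UNIV}"
  fix a b :: "'a \<Rightarrow> 'a \<Rightarrow> 'b"
  assume "(\<forall>i j. \<not> i \<le> j \<longrightarrow> a i j = 0) \<and> (\<lambda>(i, j). norm (a i j)) summable_on UNIV"
    "(\<forall>i j. \<not> i \<le> j \<longrightarrow> b i j = 0) \<and> (\<lambda>(i, j). norm (b i j)) summable_on UNIV"
  then have "a \<in> ?U" "b \<in> ?U" by - (rule CollectI; assumption)+
  note a = Abs_up_inverse[OF this(1), symmetric] and b = Abs_up_inverse[OF this(2), symmetric]
  define a' where "a' = (Abs_up a :: ('a, 'b) up)"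
  define b' where "b' = (Abs_up b :: ('a, 'b) up)"
  note a = a[folded a'_def] and b = b[folded b'_def]
  have "entry a' i k * entry b' k j = 0" if "\<not> i \<le> j" for i j k
  proof (cases "i \<le> k")
    case True
    with that have "\<not> k \<le> j" by auto
    then show ?thesis by (simp add: entry_zero)
  qed (simp add: entry_zero)
  then show "(\<forall>i j. \<not> i \<le> j \<longrightarrow> (\<Sum>\<^sub>\<infinity>k. a i k * b k j) = 0) \<and>
      (\<lambda>(i, j). norm (\<Sum>\<^sub>\<infinity>k. a i k * b k j)) summable_on UNIV"
    using up_product_norms(1)[of a' b'] unfolding a[symmetric] b[symmetric] by simp
qed

lift_definition scaleR_up :: "real \<Rightarrow> ('a, 'b) up \<Rightarrow> ('a, 'b) up" is "\<lambda>r a i j. r *\<^sub>R a i j"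
  by (intro conjI; (rule summable_norm_cmult(1))?) auto

definition norm_up :: "('a, 'b) up \<Rightarrow> real"
  where "norm_up a = (\<Sum>\<^sub>\<infinity>(i, j)\<in>UNIV. norm (entry a i j))"

definition dist_up :: "('a, 'b) up \<Rightarrow> ('a, 'b) up \<Rightarrow> real"
  where "dist_up a b = norm (a - b)"

definition sgn_up :: "('a, 'b) up \<Rightarrow> ('a, 'b) up"
  where "sgn_up a = inverse (norm a) *\<^sub>R a"

definition uniformity_up :: "(('a, 'b) up \<times> ('a, 'b) up) filter"
  where "uniformity_up = (INF e\<in>{0<..}. principal {(x, y). dist x y < e})"

definition open_up :: "('a, 'b) up set \<Rightarrow> bool"
  where "open_up U = (\<forall>x\<in>U. \<forall>\<^sub>F (x', y) in uniformity. x' = x \<longrightarrow> y \<in> U)"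

instance
proof
  note ent = zero_up.rep_eq plus_up.rep_eq uminus_up.rep_eq times_up.rep_eq scaleR_up.rep_eq
  have ps: "(\<lambda>k. entry a i k * entry b k j) summable_on UNIV" for a b :: "('a, 'b) up" and i j
    by (rule abs_summable_summable[OF up_product_abs_summable])
  have norm_ge: "norm (entry a i j) \<le> norm a" for a :: "('a, 'b) up" and i j
    using finite_sum_le_infsum[OF entry_summable[of a], of "{(i, j)}"] by (auto simp: norm_up_def)
  fix a b c :: "('a, 'b) up" and r s :: real
  show "a + b + c = a + (b + c)" "a + b = b + a" "0 + a = a" "- a + a = 0"
    "r *\<^sub>R (a + b) = r *\<^sub>R a + r *\<^sub>R b" "(r + s) *\<^sub>R a = r *\<^sub>R a + s *\<^sub>R a"
    "r *\<^sub>R s *\<^sub>R a = (r * s) *\<^sub>R a" "1 *\<^sub>R a = a"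
    by (auto intro!: up_eqI simp: ent algebra_simps)
  show "a - b = a + - b" by (simp add: minus_up_def)
  show "dist a b = norm (a - b)" by (simp add: dist_up_def)
  show "sgn a = inverse (norm a) *\<^sub>R a" by (simp add: sgn_up_def)
  show "uniformity = (INF e\<in>{0<..}. principal {(x::('a, 'b) up, y). dist x y < e})"
    by (simp add: uniformity_up_def)
  show "open U = (\<forall>x\<in>U. \<forall>\<^sub>F (x', y) in uniformity. x' = x \<longrightarrow> y \<in> U)" for U :: "('a, 'b) up set"
    by (simp add: open_up_def)
  show "(a + b) * c = a * c + b * c" "a * (b + c) = a * b + a * c"
    by (auto intro!: up_eqI simp: ent distrib_left distrib_right infsum_add ps)
  have sr: "(\<Sum>\<^sub>\<infinity>k. r *\<^sub>R f k) = r *\<^sub>R (\<Sum>\<^sub>\<infinity>k. f k)" if "f summable_on UNIV" for f :: "'a \<Rightarrow> 'b"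
    by (rule infsum_bounded_linear_strong[OF _ bounded_linear_scaleR_right])
      (simp add: that summable_on_bounded_linear[OF bounded_linear_scaleR_right])
  show "r *\<^sub>R a * b = r *\<^sub>R (a * b)" "a * r *\<^sub>R b = r *\<^sub>R (a * b)"
    by (auto intro!: up_eqI simp: ent sr ps)
  show "norm (r *\<^sub>R a) = \<bar>r\<bar> * norm a"
    unfolding norm_up_def ent by (rule summable_norm_cmult(2)[OF entry_summable]) simp
  show "(norm a = 0) = (a = 0)"
  proof
    show "a = 0" if "norm a = 0"
      using norm_ge[of a] that by (auto intro!: up_eqI simp: ent)
    show "norm a = 0" if "a = 0" using that by (simp add: norm_up_def ent case_prod_unfold)
  qed
  show "norm (a + b) \<le> norm a + norm b"
  proof -
    have s: "(\<lambda>p. norm (entry x (fst p) (snd p))) summable_on UNIV" for x :: "('a, 'b) up"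
      using entry_summable[of x] by (simp add: case_prod_unfold)
    have "(\<Sum>\<^sub>\<infinity>p. norm (entry (a + b) (fst p) (snd p))) \<le>
        (\<Sum>\<^sub>\<infinity>p. norm (entry a (fst p) (snd p)) + norm (entry b (fst p) (snd p)))"
      by (rule infsum_mono[OF s summable_on_add[OF s s]]) (simp add: ent norm_triangle_ineq)
    also have "\<dots> = (\<Sum>\<^sub>\<infinity>p. norm (entry a (fst p) (snd p))) + (\<Sum>\<^sub>\<infinity>p. norm (entry b (fst p) (snd p)))"
      by (rule infsum_add[OF s s])
    finally show ?thesis by (simp add: norm_up_def case_prod_unfold)
  qed
  show "norm (a * b) \<le> norm a * norm b"
    unfolding norm_up_def ent by (rule up_product_norms(2))
  show "a * b * c = a * (b * c)"
  proof (rule up_eqI)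
    fix i j
    define t where "t = (\<lambda>l k. entry a i k * entry b k l * entry c l j)"
    have "(\<lambda>(p, q). norm (entry a (fst p) (snd p)) * norm (entry c (fst q) (snd q))) summable_on UNIV \<times> UNIV"
    proof (rule summable_on_SigmaI)
      show "((\<lambda>q. case (p, q) of (p, q) \<Rightarrow> norm (entry a (fst p) (snd p)) * norm (entry c (fst q) (snd q)))
          has_sum norm (entry a (fst p) (snd p)) * norm c) UNIV" for p
        using has_sum_cmult_right[OF has_sum_infsum[OF entry_summable[of c]]]
        by (simp add: norm_up_def case_prod_unfold)
      show "(\<lambda>p. norm (entry a (fst p) (snd p)) * norm c) summable_on UNIV"
        using summable_on_cmult_left[OF entry_summable[of a]] by (simp add: case_prod_unfold)
    qed auto
    then have "(\<lambda>(p, q). norm (entry a (fst p) (snd p)) * norm (entry c (fst q) (snd q)))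
        summable_on range (\<lambda>(l, k). ((i, k), (l, j)))"
      by (rule summable_on_subset_banach) auto
    then have ac: "(\<lambda>(l, k). norm (entry a i k) * norm (entry c l j)) summable_on UNIV"
      by (subst (asm) summable_on_reindex) (auto simp: inj_on_def o_def case_prod_unfold)
    have "(\<lambda>p. norm (case p of (l, k) \<Rightarrow> t l k)) summable_on UNIV"
    proof (rule summable_on_comparison_test[OF summable_on_cmult_left[OF ac, of "norm b"]])
      fix p :: "'a \<times> 'a"
      obtain l k where p: "p = (l, k)" by fastforce
      have "norm (t l k) \<le> norm (entry a i k) * norm (entry b k l) * norm (entry c l j)"
        unfolding t_def by (meson norm_mult_ineq mult_right_mono norm_ge_zero order_trans)
      also have "\<dots> \<le> norm (entry a i k) * norm b * norm (entry c l j)"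
        by (intro mult_right_mono mult_left_mono norm_ge) auto
      finally show "norm (case p of (l, k) \<Rightarrow> t l k) \<le> (case p of (l, k) \<Rightarrow> norm (entry a i k) * norm (entry c l j)) * norm b"
        by (simp add: p mult_ac)
    qed auto
    then have t: "(\<lambda>(l, k). t l k) summable_on UNIV \<times> UNIV"
      using abs_summable_summable by auto
    have "entry (a * b * c) i j = (\<Sum>\<^sub>\<infinity>l. (\<Sum>\<^sub>\<infinity>k. entry a i k * entry b k l) * entry c l j)"
      by (simp add: ent)
    also have "\<dots> = (\<Sum>\<^sub>\<infinity>l. \<Sum>\<^sub>\<infinity>k. t l k)"
      unfolding t_def by (intro infsum_cong infsum_cmult_left[symmetric] ps)
    also have "\<dots> = (\<Sum>\<^sub>\<infinity>k. \<Sum>\<^sub>\<infinity>l. t l k)"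
      by (rule infsum_swap_banach[OF t])
    also have "\<dots> = (\<Sum>\<^sub>\<infinity>k. entry a i k * (\<Sum>\<^sub>\<infinity>l. entry b k l * entry c l j))"
      unfolding t_def mult.assoc by (intro infsum_cong infsum_cmult_right ps)
    finally show "entry (a * b * c) i j = entry (a * (b * c)) i j"
      by (simp add: ent)
  qed
qed

end

instantiation up :: (linorder, complex_banach_algebra) complex_banach_algebra
begin

lift_definition scaleC_up :: "complex \<Rightarrow> ('a, 'b) up \<Rightarrow> ('a, 'b) up" is "\<lambda>c a i j. scaleC c (a i j)"
  by (intro conjI; (rule summable_norm_cmult(1))?) (auto intro: norm_scaleC)

instance
proof
  note ent = zero_up.rep_eq plus_up.rep_eq uminus_up.rep_eq times_up.rep_eq scaleR_up.rep_eq scaleC_up.rep_eq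
  have ps: "(\<lambda>k. entry a i k * entry b k j) summable_on UNIV" for a b :: "('a, 'b) up" and i j
    by (rule abs_summable_summable[OF up_product_abs_summable])
  have norm_ge: "norm (entry a i j) \<le> norm a" for a :: "('a, 'b) up" and i j
    using finite_sum_le_infsum[OF entry_summable[of a], of "{(i, j)}"] by (auto simp: norm_up_def)
  fix a b c :: "('a, 'b) up" and r :: real and z w :: complex
  show "scaleC z (a + b) = scaleC z a + scaleC z b" "scaleC (z + w) a = scaleC z a + scaleC w a"
    "scaleC z (scaleC w a) = scaleC (z * w) a" "scaleC (complex_of_real r) a = r *\<^sub>R a"
    by (auto intro!: up_eqI simp: ent scaleC_add_right scaleC_add_left scaleC_scaleC scaleC_of_real)
  have bl: "bounded_linear (\<lambda>x::'b. scaleC z x)"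
  proof (rule bounded_linear_intro)
    show "scaleC z (r *\<^sub>R x) = r *\<^sub>R scaleC z x" for r and x :: 'b
      unfolding scaleC_of_real[symmetric] scaleC_scaleC by (simp only: mult.commute)
    show "norm (scaleC z x) \<le> norm x * cmod z" for x :: 'b
      by (simp add: norm_scaleC)
  qed (rule scaleC_add_right)
  have sc: "(\<Sum>\<^sub>\<infinity>k. scaleC z (f k)) = scaleC z (\<Sum>\<^sub>\<infinity>k. f k)" if "f summable_on UNIV" for f :: "'a \<Rightarrow> 'b"
    by (rule infsum_bounded_linear_strong[OF _ bl]) (simp add: that summable_on_bounded_linear[OF bl])
  show "scaleC z a * b = scaleC z (a * b)" "a * scaleC z b = scaleC z (a * b)"
    by (auto intro!: up_eqI simp: ent scaleC_mult_left scaleC_mult_right sc ps)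
  show "norm (scaleC z a) = cmod z * norm a"
    unfolding norm_up_def ent by (rule summable_norm_cmult(2)[OF entry_summable]) (rule norm_scaleC)
  show "convergent X" if X: "Cauchy X" for X :: "nat \<Rightarrow> ('a, 'b) up"
  proof -
    have sub: "entry (x - y) i j = entry x i j - entry y i j" for x y :: "('a, 'b) up" and i j
      unfolding minus_up_def ent by simp
    have C: "\<exists>N. \<forall>m\<ge>N. \<forall>n\<ge>N. norm (X m - X n) < e" if "e > 0" for e
      using CauchyD[OF X that] by blast
    have "Cauchy (\<lambda>n. entry (X n) i j)" for i j
    proof (rule CauchyI)
      fix e :: real assume "e > 0"
      with C obtain N where N: "\<forall>m\<ge>N. \<forall>n\<ge>N. norm (X m - X n) < e" by blast
      have "norm (entry (X m) i j - entry (X n) i j) < e" if "m \<ge> N" "n \<ge> N" for m n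
        using N that norm_ge[of "X m - X n" i j] unfolding sub by (meson order_le_less_trans)
      then show "\<exists>M. \<forall>m\<ge>M. \<forall>n\<ge>M. norm (entry (X m) i j - entry (X n) i j) < e" by blast
    qed
    then have "\<exists>l. (\<lambda>n. entry (X n) i j) \<longlonglongrightarrow> l" for i j
      by (simp add: Cauchy_convergent_iff convergent_def)
    then obtain L where L: "(\<lambda>n. entry (X n) i j) \<longlonglongrightarrow> L i j" for i j
      by metis
    have fin: "(\<Sum>(i, j)\<in>F. norm (entry (X m) i j - L i j)) \<le> e"
      if N: "\<forall>m\<ge>N. \<forall>n\<ge>N. norm (X m - X n) < e" and F: "finite F" and m: "m \<ge> N" for N e F m
    proof (rule LIMSEQ_le_const2)
      show "(\<lambda>n. \<Sum>(i, j)\<in>F. norm (entry (X m) i j - entry (X n) i j)) \<longlonglongrightarrow> (\<Sum>(i, j)\<in>F. norm (entry (X m) i j - L i j))"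
        unfolding case_prod_unfold by (intro tendsto_intros L)
      have "(\<Sum>(i, j)\<in>F. norm (entry (X m) i j - entry (X n) i j)) \<le> e" if "n \<ge> N" for n
      proof -
        have "(\<Sum>(i, j)\<in>F. norm (entry (X m - X n) i j)) \<le> norm (X m - X n)"
          unfolding norm_up_def by (rule finite_sum_le_infsum[OF entry_summable F]) auto
        also have "\<dots> \<le> e" using N m that by (simp add: less_imp_le)
        finally show ?thesis by (simp add: sub)
      qed
      then show "\<exists>N. \<forall>n\<ge>N. (\<Sum>(i, j)\<in>F. norm (entry (X m) i j - entry (X n) i j)) \<le> e" by blast
    qed
    have diff: "(\<lambda>(i, j). norm (entry (X m) i j - L i j)) summable_on UNIV"
      if "\<forall>m\<ge>N. \<forall>n\<ge>N. norm (X m - X n) < e" "m \<ge> N" for N e m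
      using fin[OF that(1) _ that(2)]
      by (intro nonneg_bdd_above_summable_on bdd_aboveI2[where M = e]) auto
    obtain N1 where N1: "\<forall>m\<ge>N1. \<forall>n\<ge>N1. norm (X m - X n) < 1" using C[of 1] by auto
    have tri: "norm (L i j) \<le> norm (entry (X n) i j - L i j) + norm (entry (X n) i j)" for n i j
      using norm_triangle_sub[of "L i j" "entry (X n) i j"] by (simp add: norm_minus_commute)
    have "(\<lambda>(i, j). norm (L i j)) summable_on UNIV"
      by (rule summable_on_comparison_test[OF summable_on_add[OF diff[OF N1 order_refl] entry_summable[of "X N1"]]])
        (auto intro: tri)
    moreover have "L i j = 0" if "\<not> i \<le> j" for i j
      using LIMSEQ_unique[OF L[of i j, unfolded entry_zero[OF that]] tendsto_const] .
    ultimately have "L \<in> {a. (\<forall>i j. \<not> i \<le> j \<longrightarrow> a i j = 0) \<and> (\<lambda>(i, j). norm (a i j)) summable_on UNIV}"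
      by auto
    then have eL: "entry (Abs_up L) = L" by (rule Abs_up_inverse)
    have "X \<longlonglongrightarrow> Abs_up L"
    proof (rule LIMSEQ_I)
      fix e :: real assume "e > 0"
      then obtain N where N: "\<forall>m\<ge>N. \<forall>n\<ge>N. norm (X m - X n) < e / 2" using C[of "e / 2"] by auto
      have "norm (X m - Abs_up L) < e" if "m \<ge> N" for m
      proof -
        have "norm (X m - Abs_up L) \<le> e / 2"
          unfolding norm_up_def sub eL
          by (rule infsum_le_finite_sums[OF diff[OF N that]]) (use fin[OF N _ that] in auto)
        with \<open>e > 0\<close> show ?thesis by simp
      qed
      then show "\<exists>no. \<forall>n\<ge>no. norm (X n - Abs_up L) < e" by blast
    qed
    then show ?thesis by (auto simp: convergent_def)
  qed
qed

end

text \<open>A bimodule lives on an explicit carrier inside an ambient type, since amenability quantifies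
  over all bimodules. Module actions are only required to be bounded, not contractive.\<close>

record ('b, 'x) bimodule =
  bm_carrier :: "'x set"
  bm_zero :: 'x
  bm_add :: "'x \<Rightarrow> 'x \<Rightarrow> 'x"
  bm_scale :: "complex \<Rightarrow> 'x \<Rightarrow> 'x"
  bm_norm :: "'x \<Rightarrow> real"
  bm_left :: "'b \<Rightarrow> 'x \<Rightarrow> 'x"
  bm_right :: "'x \<Rightarrow> 'b \<Rightarrow> 'x"

definition bm_diff :: "('b, 'x) bimodule \<Rightarrow> 'x \<Rightarrow> 'x \<Rightarrow> 'x" where
  "bm_diff M x y = bm_add M x (bm_scale M (-1) y)"

locale banach_bimodule =
  fixes M :: "('b::complex_banach_algebra, 'x) bimodule"
  assumes zero_closed: "bm_zero M \<in> bm_carrier M"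
    and add_closed: "\<lbrakk>x \<in> bm_carrier M; y \<in> bm_carrier M\<rbrakk> \<Longrightarrow> bm_add M x y \<in> bm_carrier M"
    and scale_closed: "x \<in> bm_carrier M \<Longrightarrow> bm_scale M c x \<in> bm_carrier M"
    and left_closed: "x \<in> bm_carrier M \<Longrightarrow> bm_left M a x \<in> bm_carrier M"
    and right_closed: "x \<in> bm_carrier M \<Longrightarrow> bm_right M x a \<in> bm_carrier M"
    and add_assoc: "\<lbrakk>x \<in> bm_carrier M; y \<in> bm_carrier M; z \<in> bm_carrier M\<rbrakk> \<Longrightarrow>
      bm_add M (bm_add M x y) z = bm_add M x (bm_add M y z)"
    and add_commute: "\<lbrakk>x \<in> bm_carrier M; y \<in> bm_carrier M\<rbrakk> \<Longrightarrow> bm_add M x y = bm_add M y x"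
    and add_zero: "x \<in> bm_carrier M \<Longrightarrow> bm_add M x (bm_zero M) = x"
    and diff_self: "x \<in> bm_carrier M \<Longrightarrow> bm_diff M x x = bm_zero M"
    and scale_add: "\<lbrakk>x \<in> bm_carrier M; y \<in> bm_carrier M\<rbrakk> \<Longrightarrow>
      bm_scale M c (bm_add M x y) = bm_add M (bm_scale M c x) (bm_scale M c y)"
    and add_scale: "x \<in> bm_carrier M \<Longrightarrow>
      bm_scale M (c + d) x = bm_add M (bm_scale M c x) (bm_scale M d x)"
    and scale_scale: "x \<in> bm_carrier M \<Longrightarrow> bm_scale M c (bm_scale M d x) = bm_scale M (c * d) x"
    and scale_one: "x \<in> bm_carrier M \<Longrightarrow> bm_scale M 1 x = x"
    and norm_eq_zero: "x \<in> bm_carrier M \<Longrightarrow> bm_norm M x = 0 \<longleftrightarrow> x = bm_zero M"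
    and norm_triangle: "\<lbrakk>x \<in> bm_carrier M; y \<in> bm_carrier M\<rbrakk> \<Longrightarrow>
      bm_norm M (bm_add M x y) \<le> bm_norm M x + bm_norm M y"
    and norm_scale: "x \<in> bm_carrier M \<Longrightarrow> bm_norm M (bm_scale M c x) = cmod c * bm_norm M x"
    and complete: "\<lbrakk>\<And>n. X n \<in> bm_carrier M;
        \<And>e. e > 0 \<Longrightarrow> \<exists>N. \<forall>m\<ge>N. \<forall>n\<ge>N. bm_norm M (bm_diff M (X m) (X n)) < e\<rbrakk> \<Longrightarrow>
      \<exists>x\<in>bm_carrier M. (\<lambda>n. bm_norm M (bm_diff M (X n) x)) \<longlonglongrightarrow> 0"
    and left_add: "\<lbrakk>x \<in> bm_carrier M; y \<in> bm_carrier M\<rbrakk> \<Longrightarrow>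
      bm_left M a (bm_add M x y) = bm_add M (bm_left M a x) (bm_left M a y)"
    and left_scale: "x \<in> bm_carrier M \<Longrightarrow> bm_left M a (bm_scale M c x) = bm_scale M c (bm_left M a x)"
    and add_left: "x \<in> bm_carrier M \<Longrightarrow> bm_left M (a + b) x = bm_add M (bm_left M a x) (bm_left M b x)"
    and scale_left: "x \<in> bm_carrier M \<Longrightarrow> bm_left M (scaleC c a) x = bm_scale M c (bm_left M a x)"
    and right_add: "\<lbrakk>x \<in> bm_carrier M; y \<in> bm_carrier M\<rbrakk> \<Longrightarrow>
      bm_right M (bm_add M x y) a = bm_add M (bm_right M x a) (bm_right M y a)"
    and right_scale: "x \<in> bm_carrier M \<Longrightarrow> bm_right M (bm_scale M c x) a = bm_scale M c (bm_right M x a)"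
    and add_right: "x \<in> bm_carrier M \<Longrightarrow> bm_right M x (a + b) = bm_add M (bm_right M x a) (bm_right M x b)"
    and scale_right: "x \<in> bm_carrier M \<Longrightarrow> bm_right M x (scaleC c a) = bm_scale M c (bm_right M x a)"
    and left_left: "x \<in> bm_carrier M \<Longrightarrow> bm_left M a (bm_left M b x) = bm_left M (a * b) x"
    and right_right: "x \<in> bm_carrier M \<Longrightarrow> bm_right M (bm_right M x a) b = bm_right M x (a * b)"
    and left_right: "x \<in> bm_carrier M \<Longrightarrow> bm_right M (bm_left M a x) b = bm_left M a (bm_right M x b)"
    and left_bounded: "\<exists>K. \<forall>a. \<forall>x\<in>bm_carrier M. bm_norm M (bm_left M a x) \<le> K * norm a * bm_norm M x"
    and right_bounded: "\<exists>K. \<forall>a. \<forall>x\<in>bm_carrier M. bm_norm M (bm_right M x a) \<le> K * bm_norm M x * norm a"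

text \<open>The dual: bounded linear functionals, made \<open>undefined\<close> off the carrier so that equality of
  functions is equality of functionals, with the operator norm and the actions
  \<open>(a \<cdot> f) x = f (x \<cdot> a)\<close> and \<open>(f \<cdot> a) x = f (a \<cdot> x)\<close>.\<close>

definition dual_bimodule :: "('b, 'x) bimodule \<Rightarrow> ('b, 'x \<Rightarrow> complex) bimodule" where
  "dual_bimodule M = \<lparr>
     bm_carrier = {f \<in> extensional (bm_carrier M).
       (\<forall>x\<in>bm_carrier M. \<forall>y\<in>bm_carrier M. f (bm_add M x y) = f x + f y) \<and>
       (\<forall>c. \<forall>x\<in>bm_carrier M. f (bm_scale M c x) = c * f x) \<and>
       (\<exists>K. \<forall>x\<in>bm_carrier M. cmod (f x) \<le> K * bm_norm M x)},
     bm_zero = (\<lambda>x\<in>bm_carrier M. 0),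
     bm_add = (\<lambda>f g. \<lambda>x\<in>bm_carrier M. f x + g x),
     bm_scale = (\<lambda>c f. \<lambda>x\<in>bm_carrier M. c * f x),
     bm_norm = (\<lambda>f. SUP x\<in>{x \<in> bm_carrier M. bm_norm M x \<le> 1}. cmod (f x)),
     bm_left = (\<lambda>a f. \<lambda>x\<in>bm_carrier M. f (bm_right M x a)),
     bm_right = (\<lambda>f a. \<lambda>x\<in>bm_carrier M. f (bm_left M a x))\<rparr>"

definition continuous_derivation :: "('b::complex_banach_algebra, 'x) bimodule \<Rightarrow> ('b \<Rightarrow> 'x) \<Rightarrow> bool" where
  "continuous_derivation M D \<longleftrightarrow>
     (\<forall>a. D a \<in> bm_carrier M) \<and>
     (\<forall>a b. D (a + b) = bm_add M (D a) (D b)) \<and>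
     (\<forall>c a. D (scaleC c a) = bm_scale M c (D a)) \<and>
     (\<forall>a b. D (a * b) = bm_add M (bm_left M a (D b)) (bm_right M (D a) b)) \<and>
     (\<exists>K. \<forall>a. bm_norm M (D a) \<le> K * norm a)"

definition inner_derivation :: "('b, 'x) bimodule \<Rightarrow> ('b \<Rightarrow> 'x) \<Rightarrow> bool" where
  "inner_derivation M D \<longleftrightarrow>
     (\<exists>x\<in>bm_carrier M. \<forall>a. D a = bm_diff M (bm_left M a x) (bm_right M x a))"

definition amenable_within :: "'x itself \<Rightarrow> 'b::complex_banach_algebra itself \<Rightarrow> bool" where
  "amenable_within _ _ \<longleftrightarrow>
     (\<forall>M :: ('b, 'x) bimodule. banach_bimodule M \<longrightarrow>
        (\<forall>D. continuous_derivation (dual_bimodule M) D \<longrightarrow> inner_derivation (dual_bimodule M) D))"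

text \<open>HOL cannot quantify over all types inside a definition, so \<open>amenable\<close> ranges over the Banach
  bimodules carried by subsets of one fixed type built from \<open>'b\<close>. This is no restriction: theorem
  \<open>amenable_imp_amenable_within\<close> below shows that an amenable algebra satisfies the defining condition
  for the Banach bimodules in every type.\<close>

definition amenable :: "'b::complex_banach_algebra itself \<Rightarrow> bool" where
  "amenable B \<longleftrightarrow> amenable_within TYPE(nat \<Rightarrow> (nat \<times> complex \<times> 'b) list) B"

lemmas dual_simps = dual_bimodule_def bimodule.simps

context banach_bimodule
begin

lemma diff_closed: "\<lbrakk>x \<in> bm_carrier M; y \<in> bm_carrier M\<rbrakk> \<Longrightarrow> bm_diff M x y \<in> bm_carrier M"
  by (simp add: bm_diff_def add_closed scale_closed)

lemmas closed = zero_closed add_closed scale_closed left_closed right_closed diff_closed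

lemma add_left_commute: "\<lbrakk>x \<in> bm_carrier M; y \<in> bm_carrier M; z \<in> bm_carrier M\<rbrakk> \<Longrightarrow>
    bm_add M x (bm_add M y z) = bm_add M y (bm_add M x z)"
  by (metis add_assoc add_commute)

lemma norm_zero: "bm_norm M (bm_zero M) = 0"
  using norm_eq_zero zero_closed by blast

lemma norm_minus: "x \<in> bm_carrier M \<Longrightarrow> bm_norm M (bm_scale M (-1) x) = bm_norm M x"
  by (simp add: norm_scale)

lemma norm_nonneg: assumes "x \<in> bm_carrier M" shows "bm_norm M x \<ge> 0"
  using norm_triangle[OF assms scale_closed[OF assms, of "-1"]] diff_self[OF assms]
  by (simp add: bm_diff_def norm_zero norm_minus assms)

lemma scale_zero: assumes "x \<in> bm_carrier M" shows "bm_scale M 0 x = bm_zero M"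
  using add_scale[OF assms, of 1 "-1"] diff_self[OF assms] by (simp add: bm_diff_def scale_one assms)

lemma diff_add: assumes "x \<in> bm_carrier M" "y \<in> bm_carrier M" "x' \<in> bm_carrier M" "y' \<in> bm_carrier M"
  shows "bm_diff M (bm_add M x y) (bm_add M x' y') = bm_add M (bm_diff M x x') (bm_diff M y y')"
  by (simp add: bm_diff_def scale_add add_assoc add_left_commute closed assms)

lemma diff_zero: "x \<in> bm_carrier M \<Longrightarrow> bm_diff M x (bm_zero M) = x"
  by (metis bm_diff_def add_zero diff_self scale_closed scale_zero scale_scale zero_closed add_commute mult_zero_right)

lemma diff_scale: "\<lbrakk>x \<in> bm_carrier M; y \<in> bm_carrier M\<rbrakk> \<Longrightarrow>
    bm_diff M (bm_scale M c x) (bm_scale M c y) = bm_scale M c (bm_diff M x y)"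
  by (simp add: bm_diff_def scale_add closed scale_scale)

lemma diff_left: "\<lbrakk>x \<in> bm_carrier M; y \<in> bm_carrier M\<rbrakk> \<Longrightarrow>
    bm_diff M (bm_left M a x) (bm_left M a y) = bm_left M a (bm_diff M x y)"
  by (simp add: bm_diff_def left_add closed left_scale)

lemma diff_right: "\<lbrakk>x \<in> bm_carrier M; y \<in> bm_carrier M\<rbrakk> \<Longrightarrow>
    bm_diff M (bm_right M x a) (bm_right M y a) = bm_right M (bm_diff M x y) a"
  by (simp add: bm_diff_def right_add closed right_scale)

lemma diff_swap: "\<lbrakk>x \<in> bm_carrier M; y \<in> bm_carrier M\<rbrakk> \<Longrightarrow> bm_diff M y x = bm_scale M (-1) (bm_diff M x y)"
  by (simp add: bm_diff_def scale_add closed scale_scale scale_one add_commute)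

lemma norm_diff_commute: "\<lbrakk>x \<in> bm_carrier M; y \<in> bm_carrier M\<rbrakk> \<Longrightarrow>
    bm_norm M (bm_diff M y x) = bm_norm M (bm_diff M x y)"
  by (subst diff_swap) (simp_all add: norm_minus diff_closed)

lemma diff_split: assumes "x \<in> bm_carrier M" "y \<in> bm_carrier M" "z \<in> bm_carrier M"
  shows "bm_diff M x z = bm_add M (bm_diff M x y) (bm_diff M y z)"
proof -
  have "bm_add M (bm_diff M x y) (bm_diff M y z) = bm_diff M (bm_add M x y) (bm_add M y z)"
    by (simp add: diff_add assms)
  also have "bm_add M y z = bm_add M z y"
    by (rule add_commute[OF assms(2,3)])
  also have "bm_diff M (bm_add M x y) (bm_add M z y) = bm_diff M x z"
    by (simp add: diff_add assms diff_self add_zero diff_closed)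
  finally show ?thesis ..
qed

lemma norm_diff_triangle: assumes "x \<in> bm_carrier M" "y \<in> bm_carrier M" "z \<in> bm_carrier M"
  shows "bm_norm M (bm_diff M x z) \<le> bm_norm M (bm_diff M x y) + bm_norm M (bm_diff M y z)"
  unfolding diff_split[OF assms] by (intro norm_triangle diff_closed assms)

lemma norm_diff_eq_zero: assumes "x \<in> bm_carrier M" "y \<in> bm_carrier M" "bm_norm M (bm_diff M x y) = 0"
  shows "x = y"
proof -
  have "bm_diff M x y = bm_zero M" using assms norm_eq_zero diff_closed by blast
  then have "bm_add M (bm_diff M x y) y = y"
    using assms by (metis add_commute add_zero zero_closed)
  moreover have "bm_add M (bm_diff M x y) y = x"
  proof -
    have "bm_add M (bm_diff M x y) y = bm_add M x (bm_add M (bm_scale M (-1) y) y)"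
      by (simp add: bm_diff_def add_assoc closed assms)
    also have "bm_add M (bm_scale M (-1) y) y = bm_diff M y y"
      unfolding bm_diff_def by (rule add_commute) (simp_all add: closed assms)
    finally have "bm_add M (bm_diff M x y) y = bm_add M x (bm_diff M y y)" .
    then show ?thesis by (simp add: diff_self assms add_zero)
  qed
  ultimately show ?thesis by simp
qed

lemma dual_norm_bound:
  assumes "f \<in> bm_carrier (dual_bimodule M)" "x \<in> bm_carrier M"
  shows "cmod (f x) \<le> bm_norm (dual_bimodule M) f * bm_norm M x"
proof -
  have "\<exists>K. \<forall>x\<in>bm_carrier M. cmod (f x) \<le> K * bm_norm M x"
    using assms(1) by (simp add: dual_simps)
  then obtain K where K: "\<And>x. x \<in> bm_carrier M \<Longrightarrow> cmod (f x) \<le> K * bm_norm M x" by blast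
  have sc: "\<And>c x. x \<in> bm_carrier M \<Longrightarrow> f (bm_scale M c x) = c * f x"
    using assms(1) by (simp add: dual_simps)
  show ?thesis
  proof (cases "bm_norm M x = 0")
    case True
    then show ?thesis using K[OF assms(2)] by simp
  next
    case False
    then have p: "bm_norm M x > 0" using norm_nonneg[OF assms(2)] by simp
    define y where "y = bm_scale M (of_real (inverse (bm_norm M x))) x"
    have y: "y \<in> bm_carrier M" "bm_norm M y = 1"
      using p by (simp_all add: y_def closed assms norm_scale norm_inverse)
    have "cmod (f y) \<le> bm_norm (dual_bimodule M) f"
      unfolding dual_simps
    proof (rule cSUP_upper)
      show "bdd_above ((\<lambda>x. cmod (f x)) ` {x \<in> bm_carrier M. bm_norm M x \<le> 1})"
      proof (rule bdd_aboveI2)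
        fix z assume z: "z \<in> {x \<in> bm_carrier M. bm_norm M x \<le> 1}"
        have "cmod (f z) \<le> \<bar>K\<bar> * bm_norm M z"
          using K[of z] z norm_nonneg[of z] by (smt (verit) mult_right_mono mem_Collect_eq)
        also have "\<dots> \<le> \<bar>K\<bar>" using z by (simp add: mult_left_le)
        finally show "cmod (f z) \<le> \<bar>K\<bar>" .
      qed
    qed (use y in simp)
    moreover have "cmod (f y) = inverse (bm_norm M x) * cmod (f x)"
      using p by (simp add: y_def sc assms norm_mult norm_inverse)
    ultimately show ?thesis using p by (simp add: field_simps)
  qed
qed

lemma dual_norm_le:
  assumes "\<And>x. x \<in> bm_carrier M \<Longrightarrow> cmod (f x) \<le> K * bm_norm M x" "K \<ge> 0"
  shows "bm_norm (dual_bimodule M) f \<le> K"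
  unfolding dual_simps
proof (rule cSUP_least)
  show "{x \<in> bm_carrier M. bm_norm M x \<le> 1} \<noteq> {}"
    using zero_closed norm_zero by force
  fix x assume "x \<in> {x \<in> bm_carrier M. bm_norm M x \<le> 1}"
  then show "cmod (f x) \<le> K"
    using assms(1)[of x] assms(2) by (smt (verit) mem_Collect_eq mult_left_le)
qed

lemma dual_mem_iff: "f \<in> bm_carrier (dual_bimodule M) \<longleftrightarrow> f \<in> extensional (bm_carrier M) \<and>
       (\<forall>x\<in>bm_carrier M. \<forall>y\<in>bm_carrier M. f (bm_add M x y) = f x + f y) \<and>
       (\<forall>c. \<forall>x\<in>bm_carrier M. f (bm_scale M c x) = c * f x) \<and>
       (\<exists>K. \<forall>x\<in>bm_carrier M. cmod (f x) \<le> K * bm_norm M x)"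
  by (simp add: dual_simps)

text \<open>Pointwise description of derivations into the dual.\<close>

lemma dual_derivation_iff:
  "continuous_derivation (dual_bimodule M) D \<longleftrightarrow>
     (\<forall>a. D a \<in> bm_carrier (dual_bimodule M)) \<and>
     (\<forall>a b. \<forall>x\<in>bm_carrier M. D (a + b) x = D a x + D b x) \<and>
     (\<forall>c a. \<forall>x\<in>bm_carrier M. D (scaleC c a) x = c * D a x) \<and>
     (\<forall>a b. \<forall>x\<in>bm_carrier M. D (a * b) x = D b (bm_right M x a) + D a (bm_left M b x)) \<and>
     (\<exists>K. \<forall>a. \<forall>x\<in>bm_carrier M. cmod (D a x) \<le> K * norm a * bm_norm M x)" (is "_ \<longleftrightarrow> ?R")
proof -
  have ext: "f = restrict g (bm_carrier M) \<longleftrightarrow> (\<forall>x\<in>bm_carrier M. f x = g x)"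
    if "f \<in> bm_carrier (dual_bimodule M)" for f g
  proof -
    have "f \<in> extensional (bm_carrier M)" using that by (simp add: dual_mem_iff)
    then show ?thesis by (auto intro: extensionalityI)
  qed
  have bd: "(\<exists>K. \<forall>a. bm_norm (dual_bimodule M) (D a) \<le> K * norm a) \<longleftrightarrow>
      (\<exists>K. \<forall>a. \<forall>x\<in>bm_carrier M. cmod (D a x) \<le> K * norm a * bm_norm M x)"
    if D: "\<forall>a. D a \<in> bm_carrier (dual_bimodule M)"
  proof
    assume "\<exists>K. \<forall>a. bm_norm (dual_bimodule M) (D a) \<le> K * norm a"
    then obtain K where K: "\<And>a. bm_norm (dual_bimodule M) (D a) \<le> K * norm a" by blast
    have "cmod (D a x) \<le> K * norm a * bm_norm M x" if "x \<in> bm_carrier M" for a x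
      using dual_norm_bound[of "D a" x] D that K[of a] norm_nonneg[OF that]
      by (meson mult_right_mono order_trans)
    then show "\<exists>K. \<forall>a. \<forall>x\<in>bm_carrier M. cmod (D a x) \<le> K * norm a * bm_norm M x" by blast
  next
    assume "\<exists>K. \<forall>a. \<forall>x\<in>bm_carrier M. cmod (D a x) \<le> K * norm a * bm_norm M x"
    then obtain K where K: "\<And>a x. x \<in> bm_carrier M \<Longrightarrow> cmod (D a x) \<le> K * norm a * bm_norm M x" by blast
    have "bm_norm (dual_bimodule M) (D a) \<le> \<bar>K\<bar> * norm a" for a
    proof (rule dual_norm_le)
      fix x assume x: "x \<in> bm_carrier M"
      have "K * norm a * bm_norm M x \<le> \<bar>K\<bar> * norm a * bm_norm M x"
        using norm_nonneg[OF x] by (intro mult_right_mono) auto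
      with K[OF x, of a] show "cmod (D a x) \<le> \<bar>K\<bar> * norm a * bm_norm M x" by simp
    qed simp
    then show "\<exists>K. \<forall>a. bm_norm (dual_bimodule M) (D a) \<le> K * norm a" by blast
  qed
  have cl: "bm_left M a x \<in> bm_carrier M" "bm_right M x a \<in> bm_carrier M" if "x \<in> bm_carrier M" for a x
    using that by (simp_all add: closed)
  show ?thesis
  proof (cases "\<forall>a. D a \<in> bm_carrier (dual_bimodule M)")
    case True
    then have e: "D a = restrict g (bm_carrier M) \<longleftrightarrow> (\<forall>x\<in>bm_carrier M. D a x = g x)" for a g
      using ext by blast
    have d: "bm_add (dual_bimodule M) f g = (\<lambda>x\<in>bm_carrier M. f x + g x)"
      "bm_scale (dual_bimodule M) c f = (\<lambda>x\<in>bm_carrier M. c * f x)"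
      "bm_left (dual_bimodule M) a f = (\<lambda>x\<in>bm_carrier M. f (bm_right M x a))"
      "bm_right (dual_bimodule M) f a = (\<lambda>x\<in>bm_carrier M. f (bm_left M a x))" for f g c a
      by (simp_all add: dual_simps)
    show ?thesis
      unfolding continuous_derivation_def bd[OF True] d e by simp
  next
    case False
    then show ?thesis unfolding continuous_derivation_def by blast
  qed
qed

lemma dual_inner_iff:
  assumes "\<And>a. D a \<in> bm_carrier (dual_bimodule M)"
  shows "inner_derivation (dual_bimodule M) D \<longleftrightarrow>
     (\<exists>f\<in>bm_carrier (dual_bimodule M). \<forall>a. \<forall>x\<in>bm_carrier M. D a x = f (bm_right M x a) - f (bm_left M a x))"
proof -
  have ext: "D a = restrict g (bm_carrier M) \<longleftrightarrow> (\<forall>x\<in>bm_carrier M. D a x = g x)" for a g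
  proof -
    have "D a \<in> extensional (bm_carrier M)" using assms[of a] by (simp add: dual_mem_iff)
    then show ?thesis by (auto intro: extensionalityI)
  qed
  have d: "bm_diff (dual_bimodule M) (bm_left (dual_bimodule M) a f) (bm_right (dual_bimodule M) f a) =
    (\<lambda>x\<in>bm_carrier M. f (bm_right M x a) - f (bm_left M a x))" for a f
    by (auto simp: bm_diff_def dual_simps)
  show ?thesis unfolding inner_derivation_def d ext by simp
qed

end

lemma inner_derivation_if_embeds:
  fixes M :: "('b::complex_banach_algebra, 'x) bimodule" and g :: "'x \<Rightarrow> 'u"
  assumes am: "amenable_within TYPE('u) TYPE('b)" and M: "banach_bimodule M"
    and inj: "inj_on g (bm_carrier M)" and D: "continuous_derivation (dual_bimodule M) D"
  shows "inner_derivation (dual_bimodule M) D"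
proof -
  interpret M: banach_bimodule M by fact
  define S where "S = bm_carrier M"
  define h where "h = inv_into S g"
  have hg: "h (g x) = x" if "x \<in> S" for x
    using that inj by (simp add: h_def S_def)
  define N :: "('b, 'u) bimodule" where "N = \<lparr>bm_carrier = g ` S, bm_zero = g (bm_zero M),
    bm_add = (\<lambda>u v. g (bm_add M (h u) (h v))), bm_scale = (\<lambda>c u. g (bm_scale M c (h u))),
    bm_norm = (\<lambda>u. bm_norm M (h u)), bm_left = (\<lambda>a u. g (bm_left M a (h u))),
    bm_right = (\<lambda>u a. g (bm_right M (h u) a))\<rparr>"
  note cl = M.closed[folded S_def]
  have N: "bm_carrier N = g ` S" "bm_zero N = g (bm_zero M)"
    "\<And>x y. x \<in> S \<Longrightarrow> y \<in> S \<Longrightarrow> bm_add N (g x) (g y) = g (bm_add M x y)"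
    "\<And>x c. x \<in> S \<Longrightarrow> bm_scale N c (g x) = g (bm_scale M c x)"
    "\<And>x. x \<in> S \<Longrightarrow> bm_norm N (g x) = bm_norm M x"
    "\<And>x a. x \<in> S \<Longrightarrow> bm_left N a (g x) = g (bm_left M a x)"
    "\<And>x a. x \<in> S \<Longrightarrow> bm_right N (g x) a = g (bm_right M x a)"
    by (simp_all add: N_def hg)
  have Nd: "bm_diff N (g x) (g y) = g (bm_diff M x y)" if "x \<in> S" "y \<in> S" for x y
    using that by (simp add: bm_diff_def N cl)
  have geq: "g x = g y \<longleftrightarrow> x = y" if "x \<in> S" "y \<in> S" for x y
    using that hg by metis
  have bN: "banach_bimodule N"
  proof
    fix X :: "nat \<Rightarrow> 'u" assume X: "\<And>n. X n \<in> bm_carrier N"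
      and C: "\<And>e. 0 < e \<Longrightarrow> \<exists>N'. \<forall>m\<ge>N'. \<forall>n\<ge>N'. bm_norm N (bm_diff N (X m) (X n)) < e"
    define Z where "Z n = h (X n)" for n
    have Z: "Z n \<in> S" "X n = g (Z n)" for n
      using X[of n] by (auto simp: Z_def N hg)
    have "\<exists>x\<in>bm_carrier M. (\<lambda>n. bm_norm M (bm_diff M (Z n) x)) \<longlonglongrightarrow> 0"
    proof (rule M.complete)
      show "Z n \<in> bm_carrier M" for n using Z by (simp add: S_def)
      show "\<exists>N'. \<forall>m\<ge>N'. \<forall>n\<ge>N'. bm_norm M (bm_diff M (Z m) (Z n)) < e" if "e > 0" for e
        using C[OF that] by (simp add: Z Nd N cl)
    qed
    then obtain x where "x \<in> S" "(\<lambda>n. bm_norm M (bm_diff M (Z n) x)) \<longlonglongrightarrow> 0"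
      by (auto simp: S_def)
    then show "\<exists>x\<in>bm_carrier N. (\<lambda>n. bm_norm N (bm_diff N (X n) x)) \<longlonglongrightarrow> 0"
      by (intro bexI[of _ "g x"]) (auto simp: Z Nd N cl)
  next
    show "\<exists>K. \<forall>a. \<forall>x\<in>bm_carrier N. bm_norm N (bm_left N a x) \<le> K * norm a * bm_norm N x"
      using M.left_bounded by (simp add: N cl flip: S_def)
    show "\<exists>K. \<forall>a. \<forall>x\<in>bm_carrier N. bm_norm N (bm_right N x a) \<le> K * bm_norm N x * norm a"
      using M.right_bounded by (simp add: N cl flip: S_def)
  qed (auto simp: N Nd cl geq M.add_assoc[folded S_def] M.add_zero[folded S_def] M.diff_self[folded S_def]
      M.scale_add[folded S_def] M.add_scale[folded S_def] M.scale_scale[folded S_def] M.scale_one[folded S_def]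
      M.norm_eq_zero[folded S_def] M.norm_triangle[folded S_def] M.norm_scale[folded S_def]
      M.left_add[folded S_def] M.left_scale[folded S_def] M.add_left[folded S_def] M.scale_left[folded S_def]
      M.right_add[folded S_def] M.right_scale[folded S_def] M.add_right[folded S_def] M.scale_right[folded S_def]
      M.left_left[folded S_def] M.right_right[folded S_def] M.left_right[folded S_def]
      intro: M.add_commute[folded S_def])
  interpret N: banach_bimodule N by fact
  note D = D[unfolded M.dual_derivation_iff, folded S_def]
  then have Da: "D a \<in> bm_carrier (dual_bimodule M)" for a by blast
  note Da' = this[unfolded M.dual_mem_iff, folded S_def]
  define D' where "D' a = (\<lambda>u\<in>g ` S. D a (h u))" for a
  have D'g: "D' a (g x) = D a x" if "x \<in> S" for a x
    using that by (simp add: D'_def hg)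
  have D'a: "D' a \<in> bm_carrier (dual_bimodule N)" for a
    unfolding N.dual_mem_iff using Da'[of a]
    by (simp add: N D'g cl) (simp add: D'_def)
  have "continuous_derivation (dual_bimodule N) D'"
    unfolding N.dual_derivation_iff using D by (simp add: D'a) (simp add: N D'g cl)
  then have "inner_derivation (dual_bimodule N) D'"
    using am bN unfolding amenable_within_def by blast
  then obtain f where f: "f \<in> bm_carrier (dual_bimodule N)"
    and Df: "\<forall>a. \<forall>u\<in>bm_carrier N. D' a u = f (bm_right N u a) - f (bm_left N a u)"
    unfolding N.dual_inner_iff[OF D'a] by blast
  define f' where "f' = (\<lambda>x\<in>S. f (g x))"
  have f'x: "f' x = f (g x)" if "x \<in> S" for x
    using that by (simp add: f'_def)
  have "f' \<in> bm_carrier (dual_bimodule M)"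
    using f unfolding N.dual_mem_iff M.dual_mem_iff S_def[symmetric]
    by (simp add: f'x cl N) (simp add: f'_def)
  moreover have "\<forall>a. \<forall>x\<in>S. D a x = f' (bm_right M x a) - f' (bm_left M a x)"
    using Df by (simp add: N f'x cl D'g)
  ultimately show ?thesis
    unfolding M.dual_inner_iff[OF Da] S_def by blast
qed

lemma closed_submodule_bimodule:
  fixes M :: "('b::complex_banach_algebra, 'a) bimodule"
  assumes "banach_bimodule M" and sub: "Y \<subseteq> bm_carrier M"
    and cl: "bm_zero M \<in> Y" "\<And>x y. x \<in> Y \<Longrightarrow> y \<in> Y \<Longrightarrow> bm_add M x y \<in> Y" "\<And>x c. x \<in> Y \<Longrightarrow> bm_scale M c x \<in> Y"
      "\<And>x a. x \<in> Y \<Longrightarrow> bm_left M a x \<in> Y" "\<And>x a. x \<in> Y \<Longrightarrow> bm_right M x a \<in> Y"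
    and closed: "\<And>x. x \<in> bm_carrier M \<Longrightarrow> (\<And>e. e > 0 \<Longrightarrow> \<exists>y\<in>Y. bm_norm M (bm_diff M x y) < e) \<Longrightarrow> x \<in> Y"
  shows "banach_bimodule (M\<lparr>bm_carrier := Y\<rparr>)"
proof -
  interpret M: banach_bimodule M by fact
  have inc: "x \<in> bm_carrier M" if "x \<in> Y" for x using sub that by blast
  have d: "bm_diff (M\<lparr>bm_carrier := Y\<rparr>) = bm_diff M"
    by (intro ext) (simp add: bm_diff_def)
  show ?thesis
  proof
    fix X :: "nat \<Rightarrow> 'a" assume X: "\<And>n. X n \<in> bm_carrier (M\<lparr>bm_carrier := Y\<rparr>)"
      and C: "\<And>e. 0 < e \<Longrightarrow> \<exists>N'. \<forall>m\<ge>N'. \<forall>n\<ge>N'. bm_norm (M\<lparr>bm_carrier := Y\<rparr>) (bm_diff (M\<lparr>bm_carrier := Y\<rparr>) (X m) (X n)) < e"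
    have XY: "X n \<in> Y" for n using X by simp
    obtain x where x: "x \<in> bm_carrier M" and lim: "(\<lambda>n. bm_norm M (bm_diff M (X n) x)) \<longlonglongrightarrow> 0"
      using M.complete[of X] inc[OF XY] C unfolding d by auto
    have "x \<in> Y"
    proof (rule closed[OF x])
      fix e :: real assume "e > 0"
      then obtain n where "bm_norm M (bm_diff M (X n) x) < e"
        using order_tendstoD(2)[OF lim, of e] by (auto simp: eventually_sequentially)
      then show "\<exists>y\<in>Y. bm_norm M (bm_diff M x y) < e"
        using XY M.norm_diff_commute[OF x inc[OF XY[of n]]] by auto
    qed
    with lim show "\<exists>x\<in>bm_carrier (M\<lparr>bm_carrier := Y\<rparr>). (\<lambda>n. bm_norm (M\<lparr>bm_carrier := Y\<rparr>) (bm_diff (M\<lparr>bm_carrier := Y\<rparr>) (X n) x)) \<longlonglongrightarrow> 0"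
      by (auto simp: d)
  next
    show "\<exists>K. \<forall>a. \<forall>x\<in>bm_carrier (M\<lparr>bm_carrier := Y\<rparr>). bm_norm (M\<lparr>bm_carrier := Y\<rparr>) (bm_left (M\<lparr>bm_carrier := Y\<rparr>) a x) \<le> K * norm a * bm_norm (M\<lparr>bm_carrier := Y\<rparr>) x"
      using M.left_bounded inc by (simp, blast)
    show "\<exists>K. \<forall>a. \<forall>x\<in>bm_carrier (M\<lparr>bm_carrier := Y\<rparr>). bm_norm (M\<lparr>bm_carrier := Y\<rparr>) (bm_right (M\<lparr>bm_carrier := Y\<rparr>) x a) \<le> K * bm_norm (M\<lparr>bm_carrier := Y\<rparr>) x * norm a"
      using M.right_bounded inc by (simp, blast)
  qed (auto simp: cl d inc M.add_assoc M.add_zero M.diff_self M.scale_add M.add_scale M.scale_scale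
      M.scale_one M.norm_eq_zero M.norm_triangle M.norm_scale M.left_add M.left_scale M.add_left M.scale_left
      M.right_add M.right_scale M.add_right M.scale_right M.left_left M.right_right M.left_right
      intro: M.add_commute)
qed

lemma closure_submodule_bimodule:
  assumes "banach_bimodule M" and sub: "Q \<subseteq> bm_carrier M"
    and cl: "bm_zero M \<in> Q" "\<And>x y. x \<in> Q \<Longrightarrow> y \<in> Q \<Longrightarrow> bm_add M x y \<in> Q" "\<And>x c. x \<in> Q \<Longrightarrow> bm_scale M c x \<in> Q"
      "\<And>x a. x \<in> Q \<Longrightarrow> bm_left M a x \<in> Q" "\<And>x a. x \<in> Q \<Longrightarrow> bm_right M x a \<in> Q"
  shows "banach_bimodule (M\<lparr>bm_carrier := {x \<in> bm_carrier M. \<forall>e>0. \<exists>q\<in>Q. bm_norm M (bm_diff M x q) < e}\<rparr>)"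
proof -
  interpret M: banach_bimodule M by fact
  define Y where "Y = {x \<in> bm_carrier M. \<forall>e>0. \<exists>q\<in>Q. bm_norm M (bm_diff M x q) < e}"
  have inc: "x \<in> bm_carrier M" if "x \<in> Q" for x using sub that by blast
  have YS: "x \<in> bm_carrier M" if "x \<in> Y" for x using that by (simp add: Y_def)
  have YQ: "\<exists>q\<in>Q. bm_norm M (bm_diff M x q) < e" if "x \<in> Y" "e > 0" for x e
    using that by (simp add: Y_def)
  have lip: "F x \<in> Y" if x: "x \<in> Y" and F: "\<And>x. x \<in> bm_carrier M \<Longrightarrow> F x \<in> bm_carrier M" "\<And>q. q \<in> Q \<Longrightarrow> F q \<in> Q"
    "\<And>x y. x \<in> bm_carrier M \<Longrightarrow> y \<in> bm_carrier M \<Longrightarrow> bm_norm M (bm_diff M (F x) (F y)) \<le> K * bm_norm M (bm_diff M x y)"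
    for F x K
    unfolding Y_def
  proof (intro CollectI conjI allI impI)
    show "F x \<in> bm_carrier M" by (intro F YS x)
    fix e :: real assume e: "e > 0"
    have "e / (\<bar>K\<bar> + 1) > 0" using e by (simp add: add_nonneg_pos)
    then obtain q where q: "q \<in> Q" "bm_norm M (bm_diff M x q) < e / (\<bar>K\<bar> + 1)"
      using YQ[OF x] by blast
    have n: "bm_norm M (bm_diff M x q) \<ge> 0"
      by (intro M.norm_nonneg M.diff_closed YS x inc q)
    have "bm_norm M (bm_diff M (F x) (F q)) \<le> K * bm_norm M (bm_diff M x q)"
      by (intro F YS x inc q)
    also have "\<dots> \<le> (\<bar>K\<bar> + 1) * bm_norm M (bm_diff M x q)"
      using n by (intro mult_right_mono) auto
    also have "\<dots> < e" using q(2) by (simp add: pos_less_divide_eq add_nonneg_pos mult.commute)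
    finally show "\<exists>q\<in>Q. bm_norm M (bm_diff M (F x) q) < e" using F(2)[OF q(1)] by blast
  qed
  obtain K1 where K1: "\<And>a x. x \<in> bm_carrier M \<Longrightarrow> bm_norm M (bm_left M a x) \<le> K1 * norm a * bm_norm M x"
    using M.left_bounded by blast
  obtain K2 where K2: "\<And>a x. x \<in> bm_carrier M \<Longrightarrow> bm_norm M (bm_right M x a) \<le> K2 * bm_norm M x * norm a"
    using M.right_bounded by blast
  have "banach_bimodule (M\<lparr>bm_carrier := Y\<rparr>)"
  proof (rule closed_submodule_bimodule)
    show "banach_bimodule M" by fact
    show "Y \<subseteq> bm_carrier M" using YS by blast
    show "bm_zero M \<in> Y"
      unfolding Y_def using cl(1) M.zero_closed M.diff_self[OF M.zero_closed] M.norm_zero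
      by (auto intro!: bexI[of _ "bm_zero M"])
    show "bm_add M x y \<in> Y" if x: "x \<in> Y" and y: "y \<in> Y" for x y
      unfolding Y_def
    proof (intro CollectI conjI allI impI)
      show "bm_add M x y \<in> bm_carrier M" by (intro M.add_closed YS x y)
      fix e :: real assume "e > 0"
      then have "e / 2 > 0" by simp
      obtain p where p: "p \<in> Q" "bm_norm M (bm_diff M x p) < e / 2" using YQ[OF x \<open>e / 2 > 0\<close>] by blast
      obtain q where q: "q \<in> Q" "bm_norm M (bm_diff M y q) < e / 2" using YQ[OF y \<open>e / 2 > 0\<close>] by blast
      have "bm_norm M (bm_diff M (bm_add M x y) (bm_add M p q)) \<le> bm_norm M (bm_diff M x p) + bm_norm M (bm_diff M y q)"
        using YS[OF x] YS[OF y] inc[OF p(1)] inc[OF q(1)]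
        by (simp add: M.diff_add M.norm_triangle M.diff_closed)
      also have "\<dots> < e" using p q by simp
      finally show "\<exists>q\<in>Q. bm_norm M (bm_diff M (bm_add M x y) q) < e" using cl(2)[OF p(1) q(1)] by blast
    qed
    show "bm_scale M c x \<in> Y" if "x \<in> Y" for x c
      by (rule lip[where F = "bm_scale M c" and K = "cmod c", OF that])
        (simp_all add: M.closed cl M.diff_scale M.norm_scale)
    show "bm_left M a x \<in> Y" if "x \<in> Y" for x a
      by (rule lip[where F = "bm_left M a" and K = "K1 * norm a", OF that])
        (simp_all add: M.closed cl M.diff_left K1)
    show "bm_right M x a \<in> Y" if "x \<in> Y" for x a
    proof (rule lip[where F = "\<lambda>x. bm_right M x a" and K = "K2 * norm a", OF that])
      show "bm_norm M (bm_diff M (bm_right M x a) (bm_right M y a)) \<le> K2 * norm a * bm_norm M (bm_diff M x y)"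
        if "x \<in> bm_carrier M" "y \<in> bm_carrier M" for x y
        using K2[of "bm_diff M x y" a] that by (simp add: M.closed M.diff_right mult_ac)
    qed (simp_all add: M.closed cl)
    show "x \<in> Y" if x: "x \<in> bm_carrier M" and lim: "\<And>e. e > 0 \<Longrightarrow> \<exists>y\<in>Y. bm_norm M (bm_diff M x y) < e" for x
      unfolding Y_def
    proof (intro CollectI conjI allI impI x)
      fix e :: real assume "e > 0"
      then have "e / 2 > 0" by simp
      obtain y where y: "y \<in> Y" "bm_norm M (bm_diff M x y) < e / 2" using lim[OF \<open>e / 2 > 0\<close>] by blast
      obtain q where q: "q \<in> Q" "bm_norm M (bm_diff M y q) < e / 2" using YQ[OF y(1) \<open>e / 2 > 0\<close>] by blast
      have "bm_norm M (bm_diff M x q) < e"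
        using M.norm_diff_triangle[OF x YS[OF y(1)] inc[OF q(1)]] y(2) q(2) by simp
      with q(1) show "\<exists>q\<in>Q. bm_norm M (bm_diff M x q) < e" by blast
    qed
  qed
  then show ?thesis by (simp only: Y_def)
qed

text \<open>The closed submodule generated by a sequence embeds into the carrier type used in
  \<open>amenable\<close>: elements of the algebraic submodule are computed by programs of a stack machine,
  and every element of the closure is determined by a sequence of approximating programs.\<close>

lemma generated_submodule:
  fixes M :: "('b::complex_banach_algebra, 'x) bimodule" and s :: "nat \<Rightarrow> 'x"
  assumes "banach_bimodule M" and s: "range s \<subseteq> bm_carrier M"
  obtains Y and g :: "'x \<Rightarrow> nat \<Rightarrow> (nat \<times> complex \<times> 'b) list" where
    "banach_bimodule (M\<lparr>bm_carrier := Y\<rparr>)" "Y \<subseteq> bm_carrier M" "range s \<subseteq> Y" "inj_on g Y"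
proof -
  interpret M: banach_bimodule M by fact
  define step :: "nat \<times> complex \<times> 'b \<Rightarrow> 'x list \<Rightarrow> 'x list" where
    "step = (\<lambda>(n, c, b) st.
      if n = 0 then bm_add M (st ! 0) (st ! 1) # drop 2 st
      else if n = 1 then bm_scale M c (hd st) # tl st
      else if n = 2 then bm_left M b (hd st) # tl st
      else if n = 3 then bm_right M (hd st) b # tl st
      else s (n - 4) # st)"
  define prog where "prog x p \<longleftrightarrow> x \<in> bm_carrier M \<and> (\<forall>st. fold step p st = x # st)" for x p
  define Q where "Q = {x. \<exists>p. prog x p}"
  have QS: "Q \<subseteq> bm_carrier M" by (auto simp: Q_def prog_def)
  have gen: "s n \<in> Q" for n
  proof -
    have "prog (s n) [(n + 4, 0, 0)]" using s by (auto simp: prog_def step_def)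
    then show ?thesis by (auto simp: Q_def)
  qed
  have add: "bm_add M x y \<in> Q" if "x \<in> Q" "y \<in> Q" for x y
  proof -
    from that obtain p q where "prog x p" "prog y q" by (auto simp: Q_def)
    then have "prog (bm_add M x y) (q @ p @ [(0, 0, 0)])"
      by (auto simp: prog_def step_def M.closed numeral_2_eq_2)
    then show ?thesis by (auto simp: Q_def)
  qed
  have scale: "bm_scale M c x \<in> Q" if "x \<in> Q" for x c
  proof -
    from that obtain p where "prog x p" by (auto simp: Q_def)
    then have "prog (bm_scale M c x) (p @ [(1, c, 0)])" by (auto simp: prog_def step_def M.closed)
    then show ?thesis by (auto simp: Q_def)
  qed
  have left: "bm_left M a x \<in> Q" if "x \<in> Q" for x a
  proof -
    from that obtain p where "prog x p" by (auto simp: Q_def)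
    then have "prog (bm_left M a x) (p @ [(2, 0, a)])" by (auto simp: prog_def step_def M.closed)
    then show ?thesis by (auto simp: Q_def)
  qed
  have right: "bm_right M x a \<in> Q" if "x \<in> Q" for x a
  proof -
    from that obtain p where "prog x p" by (auto simp: Q_def)
    then have "prog (bm_right M x a) (p @ [(3, 0, a)])" by (auto simp: prog_def step_def M.closed)
    then show ?thesis by (auto simp: Q_def)
  qed
  have zero: "bm_zero M \<in> Q"
    using scale[OF gen[of 0], of 0] M.scale_zero[of "s 0"] s by (simp add: range_subsetD)
  define Y where "Y = {x \<in> bm_carrier M. \<forall>e>0. \<exists>q\<in>Q. bm_norm M (bm_diff M x q) < e}"
  have Y: "banach_bimodule (M\<lparr>bm_carrier := Y\<rparr>)"
    unfolding Y_def by (rule closure_submodule_bimodule) (use assms(1) QS zero add scale left right in auto)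
  have "\<exists>p. \<exists>q. prog q p \<and> bm_norm M (bm_diff M x q) < 1 / real (Suc n)" if "x \<in> Y" for x n
  proof -
    have "\<exists>q\<in>Q. bm_norm M (bm_diff M x q) < 1 / real (Suc n)" using that by (simp add: Y_def)
    then show ?thesis by (auto simp: Q_def)
  qed
  then obtain g where g: "\<And>x n. x \<in> Y \<Longrightarrow> \<exists>q. prog q (g x n) \<and> bm_norm M (bm_diff M x q) < 1 / real (Suc n)"
    by metis
  have "inj_on g Y"
  proof (rule inj_onI)
    fix x y assume x: "x \<in> Y" and y: "y \<in> Y" and eq: "g x = g y"
    have xS: "x \<in> bm_carrier M" and yS: "y \<in> bm_carrier M" using x y by (auto simp: Y_def)
    have "bm_norm M (bm_diff M x y) \<le> 2 * (1 / real (Suc n))" for n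
    proof -
      obtain q where q: "prog q (g x n)" "bm_norm M (bm_diff M x q) < 1 / real (Suc n)" using g[OF x] by blast
      obtain q' where q': "prog q' (g y n)" "bm_norm M (bm_diff M y q') < 1 / real (Suc n)" using g[OF y] by blast
      have "[q] = fold step (g x n) []" "[q'] = fold step (g y n) []"
        using q(1) q'(1) by (simp_all add: prog_def)
      with eq have "[q'] = [q]" by metis
      then have "q' = q" by simp
      have qS: "q \<in> bm_carrier M" using q(1) by (simp add: prog_def)
      show ?thesis
        using M.norm_diff_triangle[OF xS qS yS] M.norm_diff_commute[OF yS qS] q(2) q'(2) \<open>q' = q\<close> by simp
    qed
    moreover have "(\<lambda>n. 2 * (1 / real (Suc n))) \<longlonglongrightarrow> 2 * 0"
      by (intro tendsto_mult_left lim_1_over_n[THEN LIMSEQ_Suc])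
    ultimately have "bm_norm M (bm_diff M x y) \<le> 0"
      by (intro LIMSEQ_le_const[where X = "\<lambda>n. 2 * (1 / real (Suc n))"]) auto
    then have "bm_norm M (bm_diff M x y) = 0"
      using M.norm_nonneg[OF M.diff_closed[OF xS yS]] by simp
    then show "x = y" by (rule M.norm_diff_eq_zero[OF xS yS])
  qed
  moreover have "range s \<subseteq> Y"
  proof
    fix x assume "x \<in> range s"
    then have "x \<in> Q" "x \<in> bm_carrier M" using gen s by auto
    moreover have "bm_norm M (bm_diff M x x) = 0" using \<open>x \<in> bm_carrier M\<close> by (simp add: M.diff_self M.norm_zero)
    ultimately show "x \<in> Y" by (auto simp: Y_def intro!: bexI[of _ x])
  qed
  moreover have "Y \<subseteq> bm_carrier M" by (auto simp: Y_def)
  ultimately show ?thesis using that Y by blast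
qed

theorem amenable_imp_amenable_within:
  assumes am: "amenable TYPE('b::complex_banach_algebra)"
  shows "amenable_within TYPE('x) TYPE('b)"
  unfolding amenable_within_def
proof (intro allI impI)
  fix M :: "('b, 'x) bimodule" and D
  assume bM: "banach_bimodule M" and D: "continuous_derivation (dual_bimodule M) D"
  interpret M: banach_bimodule M by fact
  define S where "S = bm_carrier M"
  note D = D[unfolded M.dual_derivation_iff]
  then have Da: "D a \<in> bm_carrier (dual_bimodule M)" for a by blast
  define C where "C = (\<lambda>(x, y, c, a). {f. f (bm_add M x y) = f x + f y \<and> f (bm_scale M c x) = c * f x \<and>
    D a x = f (bm_right M x a) - f (bm_left M a x)})"
  define J :: "('x \<times> 'x \<times> complex \<times> 'b) set" where "J = S \<times> S \<times> UNIV \<times> UNIV"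
  define B where "B n = (PiE UNIV (\<lambda>x. cball (0::complex) (if x \<in> S then real n * bm_norm M x else 0)))" for n
  have cB: "compact (B n)" for n
    using compactin_PiE[of "\<lambda>_. euclidean :: complex topology" UNIV
        "\<lambda>x. cball 0 (if x \<in> S then real n * bm_norm M x else 0)"]
    by (simp add: B_def euclidean_product_topology)
  have cC: "closed (C j)" for j
  proof -
    obtain x y c a where j: "j = (x, y, c, a)" by (cases j) auto
    show ?thesis
      unfolding j C_def prod.case
      by (intro closed_Collect_conj closed_Collect_eq continuous_intros continuous_on_product_coordinates)
  qed
  show "inner_derivation (dual_bimodule M) D"
  proof (cases "\<exists>n. B n \<inter> (\<Inter>j\<in>J. C j) \<noteq> {}")
    case True
    then obtain n f where fB: "f \<in> B n" and fC: "\<And>j. j \<in> J \<Longrightarrow> f \<in> C j" by blast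
    have f_add: "f (bm_add M x y) = f x + f y" if "x \<in> S" "y \<in> S" for x y
      using fC[of "(x, y, 0, 0)"] that by (auto simp: J_def C_def)
    have f: "f (bm_scale M c x) = c * f x" "D a x = f (bm_right M x a) - f (bm_left M a x)"
      if "x \<in> S" for x c a
      using fC[of "(x, x, c, a)"] that by (auto simp: J_def C_def)
    have bd: "cmod (f x) \<le> real n * bm_norm M x" if "x \<in> S" for x
      using fB that by (auto simp: B_def PiE_iff dest: spec[of _ x])
    have "restrict f S \<in> bm_carrier (dual_bimodule M)"
      unfolding M.dual_mem_iff S_def[symmetric]
      by (auto simp: f_add f M.closed[folded S_def] intro!: exI[of _ "real n"] bd)
    then show ?thesis
      unfolding M.dual_inner_iff[OF Da] S_def[symmetric]
      by (rule bexI[rotated]) (auto simp: f(2) M.closed[folded S_def])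
  next
    case False
    have "\<exists>I. finite I \<and> I \<subseteq> J \<and> B n \<inter> (\<Inter>j\<in>I. C j) = {}" for n
    proof (rule ccontr)
      assume *: "\<nexists>I. finite I \<and> I \<subseteq> J \<and> B n \<inter> (\<Inter>j\<in>I. C j) = {}"
      have "B n \<inter> (\<Inter>j\<in>J. C j) \<noteq> {}"
        by (rule compact_imp_fip_image[OF cB cC]) (use * in simp)
      with False show False by metis
    qed
    then obtain I where I: "\<And>n. finite (I n)" "\<And>n. I n \<subseteq> J" "\<And>n. B n \<inter> (\<Inter>j\<in>I n. C j) = {}"
      by metis
    define E where "E = insert (bm_zero M) (\<Union>n. fst ` I n \<union> (fst \<circ> snd) ` I n)"
    have "x \<in> S \<and> y \<in> S" if "(x, y, c, a) \<in> I n" for x y c a n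
      using I(2)[of n] that by (auto simp: J_def)
    then have E: "E \<noteq> {}" "E \<subseteq> S"
      using M.zero_closed by (fastforce simp: E_def S_def)+
    have cE: "countable E"
      unfolding E_def
      by (intro countable_insert countable_UN countable_Un countable_image countableI_type countable_finite I(1))
    define s where "s = from_nat_into E"
    have rs: "range s = E" unfolding s_def by (rule range_from_nat_into[OF E(1) cE])
    obtain Y and g :: "'x \<Rightarrow> nat \<Rightarrow> (nat \<times> complex \<times> 'b) list" where
      Y: "banach_bimodule (M\<lparr>bm_carrier := Y\<rparr>)" "Y \<subseteq> bm_carrier M" "range s \<subseteq> Y" and g: "inj_on g Y"
      using generated_submodule[OF bM, of s] E(2) by (auto simp: rs S_def)
    define N where "N = M\<lparr>bm_carrier := Y\<rparr>"
    have N: "bm_carrier N = Y" "bm_add N = bm_add M" "bm_scale N = bm_scale M" "bm_norm N = bm_norm M"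
      "bm_left N = bm_left M" "bm_right N = bm_right M" by (simp_all add: N_def)
    interpret N: banach_bimodule N using Y(1) by (simp add: N_def)
    note Ncl = N.closed[unfolded N]
    have inc: "x \<in> bm_carrier M" if "x \<in> Y" for x using Y(2) that by blast
    define D' where "D' a = restrict (D a) Y" for a
    have D'x: "D' a x = D a x" if "x \<in> Y" for a x using that by (simp add: D'_def)
    have D'a: "D' a \<in> bm_carrier (dual_bimodule N)" for a
    proof -
      have "\<exists>K. \<forall>x\<in>Y. cmod (D' a x) \<le> K * bm_norm M x"
        using Da[of a] inc unfolding M.dual_mem_iff by (metis D'x)
      moreover have "D' a \<in> extensional Y" by (simp add: D'_def)
      ultimately show ?thesis
        using Da[of a] unfolding N.dual_mem_iff M.dual_mem_iff N by (simp add: D'x Ncl inc)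
    qed
    have "\<exists>K. \<forall>a. \<forall>x\<in>bm_carrier M. cmod (D a x) \<le> K * norm a * bm_norm M x"
      using D by blast
    then have "\<exists>K. \<forall>a. \<forall>x\<in>Y. cmod (D' a x) \<le> K * norm a * bm_norm M x"
      by (metis D'x inc)
    then have "continuous_derivation (dual_bimodule N) D'"
      using D D'a unfolding N.dual_derivation_iff N by (simp add: D'x Ncl inc)
    then have "inner_derivation (dual_bimodule N) D'"
      using inner_derivation_if_embeds[of N g D'] am g N.banach_bimodule_axioms
      by (simp add: amenable_def N)
    then obtain f where f: "f \<in> bm_carrier (dual_bimodule N)"
      and Df: "\<And>a x. x \<in> Y \<Longrightarrow> D' a x = f (bm_right M x a) - f (bm_left M a x)"
      unfolding N.dual_inner_iff[OF D'a] N by blast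
    then obtain K where fK: "\<And>x. x \<in> Y \<Longrightarrow> cmod (f x) \<le> K * bm_norm M x"
      unfolding N.dual_mem_iff N by blast
    obtain n where n: "K \<le> real n" using real_arch_simple by blast
    define f' where "f' x = (if x \<in> Y then f x else 0)" for x
    have "f' \<in> B n"
      unfolding B_def
    proof (intro PiE_I)
      fix x
      have "cmod (f x) \<le> real n * bm_norm M x" if "x \<in> Y"
        using fK[OF that] n M.norm_nonneg[OF inc[OF that]] by (meson mult_right_mono order_trans)
      then show "f' x \<in> cball 0 (if x \<in> S then real n * bm_norm M x else 0)"
        using inc[of x] M.norm_nonneg[of x] by (auto simp: f'_def S_def)
    qed auto
    moreover have "f' \<in> C j" if j: "j \<in> I n" for j
    proof -
      obtain x y c a where jj: "j = (x, y, c, a)" by (cases j) auto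
      have "x \<in> E" "y \<in> E" using j jj by (force simp: E_def)+
      then have xy: "x \<in> Y" "y \<in> Y" using Y(3) rs by auto
      show ?thesis
        using f Df[OF xy(1), of a] xy unfolding N.dual_mem_iff N
        by (simp add: jj C_def f'_def Ncl D'_def)
    qed
    ultimately show ?thesis using I(3)[of n] by blast
  qed
qed

end

theory Submission
  imports Defs
begin

text \<open>
  Each of the two ways in which the index set \<open>I\<close> can fail to be a singleton produces a derivation
  that is not inner. Fix a character \<open>\<phi>\<close> of \<open>A\<close>. Since the matrices are upper triangular, every diagonal
  position \<open>i\<close> gives a character \<open>\<delta> i a = \<phi> (a\<^sub>i\<^sub>i)\<close> of \<open>UP(I, A)\<close>.

  If \<open>I\<close> is infinite, choose distinct positions \<open>s 0, s 1, \<dots>\<close>. The functional-valued map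
  \<open>D a = (x \<mapsto> \<Sum>\<^sub>k \<delta> (s k) a * x\<^sub>k)\<close> on bounded sequences is bounded because the norm of \<open>UP(I, A)\<close> is an
  \<open>l\<^sup>1\<close> norm, and it is a derivation for the module structure in which \<open>a\<close> acts on one side through the
  characters \<open>\<delta> (s k)\<close> and on the other side by \<open>0\<close>. If it were inner, then at the constant sequence
  \<open>1\<close> it would be controlled by \<open>sup\<^sub>k \<bar>\<delta> (s k) a\<bar>\<close> alone; a diagonal matrix with \<open>n\<close> entries at which
  \<open>\<phi>\<close> is \<open>1\<close> has supremum \<open>1\<close> and sum \<open>n\<close>, for every \<open>n\<close>.

  If \<open>I\<close> is finite with at least two elements, it contains adjacent \<open>i < j\<close>, with nothing in between.
  Then \<open>(a b)\<^sub>i\<^sub>j = a\<^sub>i\<^sub>i b\<^sub>i\<^sub>j + a\<^sub>i\<^sub>j b\<^sub>j\<^sub>j\<close>, so \<open>a \<mapsto> \<phi> (a\<^sub>i\<^sub>j)\<close> is a point derivation from the character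
  \<open>\<delta> i\<close> to the character \<open>\<delta> j\<close>. An inner one is a multiple of \<open>\<delta> i - \<delta> j\<close>, which vanishes at the
  matrices supported at \<open>(i, j)\<close>, whereas \<open>\<phi> (a\<^sub>i\<^sub>j)\<close> can be \<open>1\<close> there.

  Both arguments are instances of \<open>amenable_character_derivations\<close>, which carries the analysis. Over
  a singleton, \<open>UP(I, A)\<close> is isometrically isomorphic to \<open>A\<close>, and amenability passes to images under
  contractive surjective homomorphisms (\<open>amenable_surjective_hom\<close>), in either direction.
\<close>

section \<open>Derivations obtained from characters\<close>

text \<open>Characters are continuous automatically: if \<open>\<phi> y = 1\<close> with \<open>\<parallel>y\<parallel> < 1\<close>, then \<open>z \<mapsto> y + y z\<close> is a
  contraction, and applying \<open>\<phi>\<close> to its fixed point gives \<open>\<phi> z = 1 + \<phi> z\<close>. The fixed point replaces the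
  geometric series, whose partial sums are awkward to write in an algebra without unit.\<close>

lemma character_contractive:
  fixes \<phi> :: "'b::complex_banach_algebra \<Rightarrow> complex"
  assumes "\<phi> \<in> character_space"
  shows "cmod (\<phi> x) \<le> norm x"
proof (rule ccontr)
  assume "\<not> cmod (\<phi> x) \<le> norm x"
  then have lt: "norm x < cmod (\<phi> x)" by simp
  then have nz: "\<phi> x \<noteq> 0" using norm_ge_zero[of x] by auto
  note \<phi> = assms[unfolded character_space_def, simplified]
  define y where "y = scaleC (1 / \<phi> x) x"
  have y1: "\<phi> y = 1" using \<phi> nz by (simp add: y_def)
  have "norm y = norm x / cmod (\<phi> x)" by (simp add: y_def norm_scaleC norm_divide)
  then have ny: "norm y < 1" using lt nz by (simp add: divide_less_eq)
  have "\<exists>!z. y + y * z = z"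
  proof (rule banach_fix_type[where c = "norm y"])
    have "dist (y + y * u) (y + y * v) = norm (y * (u - v))" for u v
      by (simp add: dist_norm right_diff_distrib)
    then show "\<forall>u v. dist (y + y * u) (y + y * v) \<le> norm y * dist u v"
      by (simp add: dist_norm norm_mult_ineq)
  qed (use ny in auto)
  then obtain z where "y + y * z = z" by blast
  then have "\<phi> z = \<phi> y + \<phi> y * \<phi> z" using \<phi> by metis
  then show False by (simp add: y1)
qed

text \<open>The algebra acts on bounded sequences on the right by multiplication with \<open>k \<mapsto> \<phi> k a\<close> and on the left
  by multiplication with \<open>k \<mapsto> \<psi> k a\<close>. A summable family of point derivations \<open>d k\<close> then defines a
  derivation into the dual module, pairing \<open>x\<close> with \<open>d a\<close>. If it is \<open>a \<mapsto> a \<cdot> f - f \<cdot> a\<close> for some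
  functional \<open>f\<close>, evaluating at the constant sequence \<open>1\<close> yields \<open>\<Sum>\<^sub>k d k a = f (\<lambda>k. \<phi> k a - \<psi> k a)\<close>:
  the sum of the \<open>d k a\<close> is dominated by the supremum of \<open>\<phi> k a - \<psi> k a\<close>.
  Bounded sequences are bounded continuous functions on the discrete space of naturals. The zero
  functional is admitted among the \<open>\<phi> k\<close> and \<open>\<psi> k\<close> to allow trivial actions.\<close>

lemma amenable_character_derivations:
  fixes \<phi> \<psi> d :: "nat \<Rightarrow> 'b::complex_banach_algebra \<Rightarrow> complex"
  assumes am: "amenable TYPE('b)"
    and \<phi>: "\<And>k. \<phi> k \<in> insert (\<lambda>_. 0) character_space"
    and \<psi>: "\<And>k. \<psi> k \<in> insert (\<lambda>_. 0) character_space"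
    and d_add: "\<And>k a b. d k (a + b) = d k a + d k b"
    and d_scale: "\<And>k c a. d k (scaleC c a) = c * d k a"
    and d_mult: "\<And>k a b. d k (a * b) = \<phi> k a * d k b + d k a * \<psi> k b"
    and d_summable: "\<And>a. summable (\<lambda>k. cmod (d k a))"
    and d_bounded: "\<And>a. (\<Sum>k. cmod (d k a)) \<le> C * norm a"
  obtains K where "\<And>a r. (\<And>k. cmod (\<phi> k a - \<psi> k a) \<le> r) \<Longrightarrow> cmod (\<Sum>k. d k a) \<le> K * r"
proof -
  define mul :: "(nat \<Rightarrow> complex) \<Rightarrow> (nat \<Rightarrow>\<^sub>C complex) \<Rightarrow> (nat \<Rightarrow>\<^sub>C complex)"
    where "mul w x = Bcontfun (\<lambda>k. w k * apply_bcontfun x k)" for w x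
  have mul: "apply_bcontfun (mul w x) k = w k * apply_bcontfun x k"
    if "\<And>k. cmod (w k) \<le> r" for w r x k
  proof -
    have "cmod (w k * apply_bcontfun x k) \<le> r * norm x" for k
      using that[of k] norm_bounded[of x k] order_trans[OF norm_ge_zero that[of k]]
      by (simp add: norm_mult mult_mono)
    then show ?thesis
      unfolding mul_def by (subst Bcontfun_inverse) (auto simp: bcontfun_def bounded_iff)
  qed
  have hom: "\<theta> (a + b) = \<theta> a + \<theta> b" "\<theta> (scaleC c a) = c * \<theta> a" "\<theta> (a * b) = \<theta> a * \<theta> b"
    "cmod (\<theta> a) \<le> norm a"
    if "\<theta> \<in> insert (\<lambda>_. 0) character_space" for \<theta> :: "'b \<Rightarrow> complex" and a b c
    using that character_contractive[of \<theta>] by (auto simp: character_space_def)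
  note \<phi>h = hom[OF \<phi>] and \<psi>h = hom[OF \<psi>]
  note mul_\<phi> = mul[of "\<lambda>k. \<phi> k _", OF \<phi>h(4)]
  note mul_\<psi> = mul[of "\<lambda>k. \<psi> k _", OF \<psi>h(4)]
  note mul_c = mul[of "\<lambda>_. _", OF order_refl]
  note mul_simps = mul_\<phi> mul_\<psi> mul_c
  have mul_norm: "norm (mul w x) \<le> r * norm x" if "\<And>k. cmod (w k) \<le> r" for w r x
  proof (rule norm_bound)
    show "cmod (apply_bcontfun (mul w x) k) \<le> r * norm x" for k
      using that[of k] norm_bounded[of x k] order_trans[OF norm_ge_zero that[of k]]
      by (simp add: mul[OF that] norm_mult mult_mono)
  qed
  define M :: "('b, nat \<Rightarrow>\<^sub>C complex) bimodule" where "M = \<lparr>bm_carrier = UNIV, bm_zero = 0,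
    bm_add = (+), bm_scale = (\<lambda>c. mul (\<lambda>_. c)), bm_norm = norm,
    bm_left = (\<lambda>a. mul (\<lambda>k. \<psi> k a)), bm_right = (\<lambda>x a. mul (\<lambda>k. \<phi> k a) x)\<rparr>"
  have M: "bm_carrier M = UNIV" "bm_zero M = 0" "bm_add M = (+)" "bm_scale M c = mul (\<lambda>_. c)"
    "bm_norm M = norm" "bm_left M a = mul (\<lambda>k. \<psi> k a)" "bm_right M x a = mul (\<lambda>k. \<phi> k a) x" for c a x
    by (simp_all add: M_def)
  have diff: "bm_diff M x y = x - y" for x y
    by (rule bcontfun_eqI) (simp add: bm_diff_def M mul_simps)
  \<comment> \<open>Multiplication by \<open>1 / c\<close> undoes multiplication by \<open>c\<close>, so two upper bounds give equality.\<close>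
  have norm_mul_c: "norm (mul (\<lambda>_. c) x) = cmod c * norm x" for c x
  proof (cases "c = 0")
    case True
    then show ?thesis using mul_norm[of "\<lambda>_. c" 0 x] by simp
  next
    case False
    have "mul (\<lambda>_. 1 / c) (mul (\<lambda>_. c) x) = x"
      by (rule bcontfun_eqI) (simp add: mul_simps False)
    then have "norm x \<le> cmod (1 / c) * norm (mul (\<lambda>_. c) x)"
      using mul_norm[of "\<lambda>_. 1 / c" "cmod (1 / c)" "mul (\<lambda>_. c) x"] by simp
    then show ?thesis
      using mul_norm[of "\<lambda>_. c" "cmod c" x] False by (simp add: norm_divide field_simps)
  qed
  interpret M: banach_bimodule M
  proof
    fix X :: "nat \<Rightarrow> (nat \<Rightarrow>\<^sub>C complex)"
    assume "\<And>e. 0 < e \<Longrightarrow> \<exists>N. \<forall>m\<ge>N. \<forall>n\<ge>N. bm_norm M (bm_diff M (X m) (X n)) < e"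
    then have "Cauchy X" by (intro CauchyI) (simp add: M diff)
    then obtain l where l: "uniform_limit UNIV (\<lambda>n. apply_bcontfun (X n)) l sequentially"
      using uniformly_convergent_eq_cauchy[of "\<lambda>_. True" "\<lambda>n. apply_bcontfun (X n)"]
      unfolding Cauchy_def uniform_limit_sequentially_iff by (metis dist_fun_lt_imp_dist_val_lt)
    \<comment> \<open>The uniform limit of bounded sequences is again bounded.\<close>
    obtain x where "X \<longlonglongrightarrow> x" using uniform_limit_bcontfunE[OF l] by auto
    then have "(\<lambda>n. norm (X n - x)) \<longlonglongrightarrow> 0" by (rule tendsto_norm_zero[OF LIM_zero])
    then show "\<exists>x\<in>bm_carrier M. (\<lambda>n. bm_norm M (bm_diff M (X n) x)) \<longlonglongrightarrow> 0"
      unfolding M diff by blast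
  next
    show "\<exists>K. \<forall>a. \<forall>x\<in>bm_carrier M. bm_norm M (bm_left M a x) \<le> K * norm a * bm_norm M x"
      by (rule exI[of _ 1]) (simp add: M mul_norm \<psi>h(4))
    show "\<exists>K. \<forall>a. \<forall>x\<in>bm_carrier M. bm_norm M (bm_right M x a) \<le> K * bm_norm M x * norm a"
      using mul_norm[OF \<phi>h(4)] by (intro exI[of _ 1]) (simp add: M mult.commute)
  qed (simp_all add: M diff norm_mul_c norm_triangle_ineq,
      (rule bcontfun_eqI, (simp add: mul_simps; simp add: \<phi>h(1-3) \<psi>h(1-3) algebra_simps))+)
  have term_le: "cmod (d k a * apply_bcontfun x k) \<le> cmod (d k a) * norm x" for k a x
    using norm_bounded[of x k] by (simp add: norm_mult mult_left_mono)
  have summ: "summable (\<lambda>k. d k a * apply_bcontfun x k)" for a x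
    by (rule summable_comparison_test'[OF summable_mult2[OF d_summable[of a], of "norm x"]]) (rule term_le)
  define D where "D a x = (\<Sum>k. d k a * apply_bcontfun x k)" for a x
  have D_le: "cmod (D a x) \<le> C * norm a * norm x" for a x
  proof -
    have "cmod (D a x) \<le> (\<Sum>k. cmod (d k a) * norm x)"
      unfolding D_def by (rule norm_suminf_le[OF term_le summable_mult2[OF d_summable]])
    also have "\<dots> = (\<Sum>k. cmod (d k a)) * norm x"
      by (rule suminf_mult2[OF d_summable, symmetric])
    also have "\<dots> \<le> C * norm a * norm x"
      by (rule mult_right_mono[OF d_bounded]) simp
    finally show ?thesis .
  qed
  have D_dual: "D a \<in> bm_carrier (dual_bimodule M)" for a
    unfolding M.dual_mem_iff M
  proof (intro conjI ballI allI exI)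
    show "D a (x + y) = D a x + D a y" for x y
      unfolding D_def suminf_add[OF summ summ] by (simp add: distrib_left)
    show "D a (mul (\<lambda>_. c) x) = c * D a x" for c x
      unfolding D_def suminf_mult[OF summ, symmetric] by (simp add: mul_c mult_ac)
    show "cmod (D a x) \<le> (C * norm a) * norm x" for x by (rule D_le)
  qed simp
  have "continuous_derivation (dual_bimodule M) D"
    unfolding M.dual_derivation_iff M
  proof (intro conjI ballI allI exI)
    show "D a \<in> bm_carrier (dual_bimodule M)" for a by (rule D_dual)
    show "D (a + b) x = D a x + D b x" for a b x
      unfolding D_def suminf_add[OF summ summ] by (simp add: d_add distrib_right)
    show "D (scaleC c a) x = c * D a x" for c a x
      unfolding D_def suminf_mult[OF summ, symmetric] by (simp add: d_scale mult_ac)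
    show "D (a * b) x = D b (mul (\<lambda>k. \<phi> k a) x) + D a (mul (\<lambda>k. \<psi> k b) x)" for a b x
      unfolding D_def suminf_add[OF summ summ] by (simp add: d_mult mul_simps algebra_simps)
    show "cmod (D a x) \<le> C * norm a * norm x" for a x by (rule D_le)
  qed
  then have "inner_derivation (dual_bimodule M) D"
    using amenable_imp_amenable_within[OF am] M.banach_bimodule_axioms
    unfolding amenable_within_def by blast
  then obtain f where f: "f \<in> bm_carrier (dual_bimodule M)"
    and Df: "\<And>a x. D a x = f (mul (\<lambda>k. \<phi> k a) x) - f (mul (\<lambda>k. \<psi> k a) x)"
    unfolding M.dual_inner_iff[OF D_dual] M by blast
  then obtain K where K: "\<And>x. cmod (f x) \<le> K * norm x"
    unfolding M.dual_mem_iff M by blast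
  have f_add: "f (x + y) = f x + f y" for x y
    using f unfolding M.dual_mem_iff M by blast
  have f_diff: "f (x - y) = f x - f y" for x y
    using f_add[of "x - y" y] by simp
  define e :: "nat \<Rightarrow>\<^sub>C complex" where "e = const_bcontfun 1"
  have e: "apply_bcontfun e k = 1" for k by (simp add: e_def)
  show thesis
  proof (rule that)
    fix a r assume r: "\<And>k. cmod (\<phi> k a - \<psi> k a) \<le> r"
    have "(\<Sum>k. d k a) = D a e" by (simp add: D_def e)
    also have "\<dots> = f (mul (\<lambda>k. \<phi> k a) e - mul (\<lambda>k. \<psi> k a) e)" by (simp add: Df f_diff)
    finally have "cmod (\<Sum>k. d k a) \<le> \<bar>K\<bar> * norm (mul (\<lambda>k. \<phi> k a) e - mul (\<lambda>k. \<psi> k a) e)"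
      using K by (smt (verit) mult_right_mono norm_ge_zero)
    also have "\<dots> \<le> \<bar>K\<bar> * r"
      by (intro mult_left_mono norm_bound) (simp_all add: mul_simps e r)
    finally show "cmod (\<Sum>k. d k a) \<le> \<bar>K\<bar> * r" .
  qed
qed

section \<open>Amenability of homomorphic images\<close>

text \<open>Modules and derivations pull back along \<open>\<theta>\<close>, and a functional implementing the derivation
  pulled back implements the original one at every value of \<open>\<theta>\<close>. The modules involved have the
  carrier type of the definition of amenability for the target algebra, which is not the one for the
  source; amenability of the source therefore has to be applied in its form for arbitrary carrier
  types.\<close>

lemma amenable_surjective_hom:
  fixes \<theta> :: "'b::complex_banach_algebra \<Rightarrow> 'c::complex_banach_algebra"
  assumes am: "amenable TYPE('b)" and "surj \<theta>"
    and \<theta>_add: "\<And>a b. \<theta> (a + b) = \<theta> a + \<theta> b"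
    and \<theta>_scale: "\<And>c a. \<theta> (scaleC c a) = scaleC c (\<theta> a)"
    and \<theta>_mult: "\<And>a b. \<theta> (a * b) = \<theta> a * \<theta> b"
    and \<theta>_bounded: "\<And>a. norm (\<theta> a) \<le> norm a"
  shows "amenable TYPE('c)"
  unfolding amenable_def amenable_within_def
proof (intro allI impI)
  fix M :: "('c, nat \<Rightarrow> (nat \<times> complex \<times> 'c) list) bimodule" and D
  assume bM: "banach_bimodule M" and D: "continuous_derivation (dual_bimodule M) D"
  interpret M: banach_bimodule M by fact
  define N :: "('b, nat \<Rightarrow> (nat \<times> complex \<times> 'c) list) bimodule" where
    "N = \<lparr>bm_carrier = bm_carrier M, bm_zero = bm_zero M, bm_add = bm_add M, bm_scale = bm_scale M,
      bm_norm = bm_norm M, bm_left = (\<lambda>a. bm_left M (\<theta> a)), bm_right = (\<lambda>x a. bm_right M x (\<theta> a))\<rparr>"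
  have N: "bm_carrier N = bm_carrier M" "bm_zero N = bm_zero M" "bm_add N = bm_add M"
    "bm_scale N = bm_scale M" "bm_norm N = bm_norm M" "bm_left N a = bm_left M (\<theta> a)"
    "bm_right N x a = bm_right M x (\<theta> a)" "bm_diff N = bm_diff M" for a x
    by (simp_all add: N_def bm_diff_def fun_eq_iff)
  have weaken: "\<exists>K. \<forall>a. \<forall>x\<in>bm_carrier M. p (\<theta> a) x \<le> K * norm a * bm_norm M x"
    if bound: "\<exists>K. \<forall>a. \<forall>x\<in>bm_carrier M. p a x \<le> K * norm a * bm_norm M x" for p :: "'c \<Rightarrow> _ \<Rightarrow> real"
  proof -
    obtain K where K: "\<And>a x. x \<in> bm_carrier M \<Longrightarrow> p a x \<le> K * norm a * bm_norm M x" using bound by blast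
    have "p (\<theta> a) x \<le> \<bar>K\<bar> * norm a * bm_norm M x" if x: "x \<in> bm_carrier M" for a x
    proof -
      have "K * norm (\<theta> a) \<le> \<bar>K\<bar> * norm a"
        by (intro mult_mono \<theta>_bounded) auto
      then show ?thesis
        using K[OF x, of "\<theta> a"] mult_right_mono[OF _ M.norm_nonneg[OF x]] order_trans by blast
    qed
    then show ?thesis by blast
  qed
  have bN: "banach_bimodule N"
  proof
    show "\<exists>K. \<forall>a. \<forall>x\<in>bm_carrier N. bm_norm N (bm_left N a x) \<le> K * norm a * bm_norm N x"
      unfolding N by (rule weaken[OF M.left_bounded])
    show "\<exists>K. \<forall>a. \<forall>x\<in>bm_carrier N. bm_norm N (bm_right N x a) \<le> K * bm_norm N x * norm a"
      unfolding N using weaken[of "\<lambda>a x. bm_norm M (bm_right M x a)"] M.right_bounded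
      by (simp add: mult_ac)
  qed (auto simp: N M.closed M.add_assoc M.add_zero M.diff_self M.scale_add M.add_scale M.scale_scale
      M.scale_one M.norm_eq_zero M.norm_triangle M.norm_scale M.left_add M.left_scale M.add_left M.scale_left
      M.right_add M.right_scale M.add_right M.scale_right M.left_left M.right_right M.left_right
      \<theta>_add \<theta>_scale \<theta>_mult intro: M.add_commute M.complete)
  interpret N: banach_bimodule N by fact
  have dual: "bm_carrier (dual_bimodule N) = bm_carrier (dual_bimodule M)"
    by (simp add: dual_simps N)
  note D = D[unfolded M.dual_derivation_iff]
  then have D_dual: "D a \<in> bm_carrier (dual_bimodule M)" for a by blast
  have "continuous_derivation (dual_bimodule N) (\<lambda>a. D (\<theta> a))"
    unfolding N.dual_derivation_iff N dual \<theta>_add \<theta>_scale \<theta>_mult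
    using D weaken[of "\<lambda>a x. cmod (D a x)"] by blast
  then have "inner_derivation (dual_bimodule N) (\<lambda>a. D (\<theta> a))"
    using amenable_imp_amenable_within[OF am] bN unfolding amenable_within_def by blast
  then obtain f where "f \<in> bm_carrier (dual_bimodule M)"
    and "\<And>a x. x \<in> bm_carrier M \<Longrightarrow> D (\<theta> a) x = f (bm_right M x (\<theta> a)) - f (bm_left M (\<theta> a) x)"
    using N.dual_inner_iff[of "\<lambda>a. D (\<theta> a)"] D_dual unfolding dual N by blast
  then show "inner_derivation (dual_bimodule M) D"
    unfolding M.dual_inner_iff[OF D_dual] using \<open>surj \<theta>\<close> by (metis surjD)
qed

section \<open>Entries of products of upper triangular matrices\<close>

lemma entry_norm_le: "norm (entry a i j) \<le> norm a"
  using finite_sum_le_infsum[OF entry_summable[of a], of "{(i, j)}"] by (auto simp: norm_up_def)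

lemma exists_up_finite_support:
  fixes m :: "'i::linorder \<Rightarrow> 'i \<Rightarrow> 'a::complex_banach_algebra"
  assumes fin: "finite {(i, j). m i j \<noteq> 0}" and upper: "\<And>i j. \<not> i \<le> j \<Longrightarrow> m i j = 0"
  obtains a where "entry a = m"
proof -
  have "(\<lambda>(i, j). norm (m i j)) summable_on UNIV \<longleftrightarrow>
      (\<lambda>(i, j). norm (m i j)) summable_on {(i, j). m i j \<noteq> 0}"
    by (rule summable_on_cong_neutral) auto
  then have "(\<lambda>(i, j). norm (m i j)) summable_on UNIV" using fin by simp
  with upper have "entry (Abs_up m) = m" by (intro Abs_up_inverse) auto
  then show thesis by (rule that)
qed

text \<open>Only indices between \<open>i\<close> and \<open>j\<close> contribute to the entry \<open>(i, j)\<close> of a product, which turns the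
  infinite sum into a finite one whenever that interval is finite.\<close>

lemma entry_mult_support:
  assumes "finite F" and "\<And>k. i \<le> k \<Longrightarrow> k \<le> j \<Longrightarrow> k \<in> F"
  shows "entry (a * b) i j = (\<Sum>k\<in>F. entry a i k * entry b k j)"
proof -
  have "entry a i k * entry b k j = 0" if "k \<notin> F" for k
    using assms(2)[of k] that entry_zero[of i k a] entry_zero[of k j b]
    by (cases "i \<le> k"; cases "k \<le> j") simp_all
  then have "entry (a * b) i j = (\<Sum>\<^sub>\<infinity>k\<in>F. entry a i k * entry b k j)"
    unfolding times_up.rep_eq by (intro infsum_cong_neutral) auto
  with \<open>finite F\<close> show ?thesis by simp
qed

lemma entry_mult_diagonal: "entry (a * b) i i = entry a i i * entry b i i"
  using entry_mult_support[of "{i}" i i a b] by auto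

lemma entry_mult_adjacent:
  assumes "i < j" and "\<And>k. i < k \<Longrightarrow> \<not> k < j"
  shows "entry (a * b) i j = entry a i i * entry b i j + entry a i j * entry b j j"
proof -
  have "k \<in> {i, j}" if "i \<le> k" "k \<le> j" for k
    using assms(2)[of k] that by (auto simp: le_less)
  then show ?thesis using entry_mult_support[of "{i, j}" i j a b] assms(1) by auto
qed

lemma diagonal_character:
  fixes \<phi> :: "'a::complex_banach_algebra \<Rightarrow> complex" and i :: "'i::linorder"
  assumes "\<phi> \<in> character_space"
  shows "(\<lambda>a. \<phi> (entry a i i)) \<in> character_space"
proof -
  obtain u where u: "\<phi> u \<noteq> 0" using assms by (auto simp: character_space_def)
  obtain a :: "('i, 'a) up" where "entry a = (\<lambda>p q. if p = i \<and> q = i then u else 0)"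
    by (rule exists_up_finite_support[of "\<lambda>p q. if p = i \<and> q = i then u else 0"])
      (auto intro: finite_subset[of _ "{(i, i)}"])
  with u have "\<exists>a. \<phi> (entry a i i) \<noteq> 0" by (auto intro!: exI[of _ a])
  then show ?thesis
    using assms by (simp add: character_space_def plus_up.rep_eq scaleC_up.rep_eq entry_mult_diagonal)
qed

text \<open>The diagonal positions \<open>s k\<close> are distinct, so these terms are dominated by distinct terms of the
  \<open>l\<^sup>1\<close> norm.\<close>

lemma diagonal_sequence_sum:
  fixes s :: "nat \<Rightarrow> 'i::linorder"
  assumes \<phi>: "\<phi> \<in> character_space" and "inj s"
  shows "summable (\<lambda>k. cmod (\<phi> (entry a (s k) (s k))))" (is "summable ?f")
    and "(\<Sum>k. cmod (\<phi> (entry a (s k) (s k)))) \<le> norm a"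
proof -
  have part: "(\<Sum>k<n. ?f k) \<le> norm a" for n
  proof -
    have "(\<Sum>k<n. ?f k) \<le> (\<Sum>k<n. norm (entry a (s k) (s k)))"
      by (intro sum_mono character_contractive \<phi>)
    also have "\<dots> = (\<Sum>(i, j)\<in>(\<lambda>k. (s k, s k)) ` {..<n}. norm (entry a i j))"
      using \<open>inj s\<close> by (subst sum.reindex) (auto simp: inj_on_def)
    also have "\<dots> \<le> norm a"
      unfolding norm_up_def by (rule finite_sum_le_infsum[OF entry_summable]) auto
    finally show ?thesis .
  qed
  show summ: "summable ?f" by (rule summableI_nonneg_bounded[OF _ part]) simp
  show "suminf ?f \<le> norm a" by (rule suminf_le_const[OF summ part])
qed

section \<open>Index sets of amenable matrix algebras\<close>

lemma character_normalized:
  fixes \<phi> :: "'a::complex_banach_algebra \<Rightarrow> complex"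
  assumes "\<phi> \<in> character_space"
  obtains u where "\<phi> u = 1" "\<phi> 0 = 0"
proof -
  note \<phi> = assms[unfolded character_space_def, simplified]
  then obtain v where v: "\<phi> v \<noteq> 0" by blast
  then have "\<phi> (scaleC (1 / \<phi> v) v) = 1" using \<phi> by simp
  moreover have "\<phi> 0 = 0" using \<phi> by (metis add_0 add_cancel_right_right)
  ultimately show thesis by (rule that)
qed

text \<open>Along an infinite sequence of positions, take the diagonal characters as derivations from
  themselves to \<open>0\<close>: amenability would bound the absolute value of the sum of the values \<open>\<phi> (a\<^sub>i\<^sub>i)\<close>
  by their supremum, which fails for long blocks of ones.\<close>

lemma amenable_up_imp_finite:
  fixes \<phi> :: "'a::complex_banach_algebra \<Rightarrow> complex"
  assumes \<phi>: "\<phi> \<in> character_space" and am: "amenable TYPE(('i::linorder, 'a) up)"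
  shows "finite (UNIV :: 'i set)"
proof (rule ccontr)
  assume "infinite (UNIV :: 'i set)"
  then obtain s :: "nat \<Rightarrow> 'i" where s: "inj s" by (auto simp: infinite_iff_countable_subset)
  obtain u where u: "\<phi> u = 1" "\<phi> 0 = 0" by (rule character_normalized[OF \<phi>])
  define \<delta> :: "nat \<Rightarrow> ('i, 'a) up \<Rightarrow> complex" where "\<delta> k a = \<phi> (entry a (s k) (s k))" for k a
  have \<delta>: "\<delta> k \<in> character_space" for k
    unfolding \<delta>_def by (rule diagonal_character[OF \<phi>])
  obtain K where K: "\<And>a r. (\<And>k. cmod (\<delta> k a - 0) \<le> r) \<Longrightarrow> cmod (\<Sum>k. \<delta> k a) \<le> K * r"
  proof (rule amenable_character_derivations[OF am, of \<delta> "\<lambda>_ _. 0" \<delta> 1])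
    show "summable (\<lambda>k. cmod (\<delta> k a))" "(\<Sum>k. cmod (\<delta> k a)) \<le> 1 * norm a" for a
      using diagonal_sequence_sum[OF \<phi> s, of a] by (simp_all add: \<delta>_def)
  qed (use \<delta> in \<open>auto simp: character_space_def\<close>)
  obtain n where n: "K < real n" using reals_Archimedean2 by blast
  obtain a :: "('i, 'a) up" where a: "entry a = (\<lambda>p q. if p = q \<and> p \<in> s ` {..<n} then u else 0)"
    by (rule exists_up_finite_support[of "\<lambda>p q. if p = q \<and> p \<in> s ` {..<n} then u else 0"])
      (auto intro: finite_subset[of _ "s ` {..<n} \<times> s ` {..<n}"])
  have \<delta>a: "\<delta> k a = (if k < n then 1 else 0)" for k
    using s u by (auto simp: \<delta>_def a inj_eq)
  have "cmod (\<Sum>k. \<delta> k a) \<le> K * 1" by (rule K) (simp add: \<delta>a)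
  moreover have "(\<Sum>k. \<delta> k a) = (\<Sum>k<n. \<delta> k a)"
    by (rule suminf_finite) (auto simp: \<delta>a)
  ultimately show False using n by (simp add: \<delta>a)
qed

text \<open>For an adjacent pair the entry \<open>(i, j)\<close> is a point derivation between the two diagonal characters.
  It is not a multiple of their difference, as the matrices supported at \<open>(i, j)\<close> show.\<close>

lemma amenable_up_no_adjacent:
  fixes \<phi> :: "'a::complex_banach_algebra \<Rightarrow> complex" and i j :: "'i::linorder"
  assumes \<phi>: "\<phi> \<in> character_space" and am: "amenable TYPE(('i, 'a) up)" and "i < j"
  shows "\<exists>k. i < k \<and> k < j"
proof (rule ccontr)
  assume "\<nexists>k. i < k \<and> k < j"
  then have adjacent: "\<And>k. i < k \<Longrightarrow> \<not> k < j" by blast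
  obtain u where u: "\<phi> u = 1" "\<phi> 0 = 0" by (rule character_normalized[OF \<phi>])
  \<comment> \<open>A single point derivation, placed at index 0 of an otherwise vanishing family.\<close>
  define d :: "nat \<Rightarrow> ('i, 'a) up \<Rightarrow> complex" where "d k a = (if k = 0 then \<phi> (entry a i j) else 0)" for k a
  have d_sums: "(\<lambda>k. d k a) sums \<phi> (entry a i j)" "(\<lambda>k. cmod (d k a)) sums cmod (\<phi> (entry a i j))" for a
    using sums_single[of 0 "\<lambda>_. \<phi> (entry a i j)"] sums_single[of 0 "\<lambda>_. cmod (\<phi> (entry a i j))"]
    by (simp_all add: d_def if_distrib[of cmod] cong: if_cong)
  have vanish: "\<phi> (entry a i j) = 0" if eq: "\<phi> (entry a i i) = \<phi> (entry a j j)" for a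
  proof (rule amenable_character_derivations[OF am,
        of "\<lambda>_ a. \<phi> (entry a i i)" "\<lambda>_ a. \<phi> (entry a j j)" d 1])
    fix K
    assume K: "\<And>a r. (\<And>k::nat. cmod (\<phi> (entry a i i) - \<phi> (entry a j j)) \<le> r) \<Longrightarrow> cmod (\<Sum>k. d k a) \<le> K * r"
    show ?thesis
      using K[of a 0] eq by (simp add: sums_unique[OF d_sums(1), symmetric])
  next
    show "(\<lambda>a. \<phi> (entry a i i)) \<in> insert (\<lambda>_. 0) character_space"
      "(\<lambda>a. \<phi> (entry a j j)) \<in> insert (\<lambda>_. 0) character_space"
      by (simp_all add: diagonal_character[OF \<phi>])
    show "d k (a * b) = \<phi> (entry a i i) * d k b + d k a * \<phi> (entry b j j)" for k a b
      using \<phi> by (simp add: d_def character_space_def entry_mult_adjacent[OF \<open>i < j\<close> adjacent])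
    show "d k (a + b) = d k a + d k b" "d k (scaleC c a) = c * d k a" for k a b c
      using \<phi> by (simp_all add: d_def character_space_def plus_up.rep_eq scaleC_up.rep_eq)
    show "summable (\<lambda>k. cmod (d k a))" for a
      using d_sums(2) by (rule sums_summable)
    show "(\<Sum>k. cmod (d k a)) \<le> 1 * norm a" for a
      using character_contractive[OF \<phi>, of "entry a i j"] entry_norm_le[of a i j]
      by (simp add: sums_unique[OF d_sums(2), symmetric])
  qed
  obtain a :: "('i, 'a) up" where a: "entry a = (\<lambda>p q. if p = i \<and> q = j then u else 0)"
    by (rule exists_up_finite_support[of "\<lambda>p q. if p = i \<and> q = j then u else 0"])
      (use \<open>i < j\<close> in \<open>auto intro: finite_subset[of _ "{(i, j)}"]\<close>)
  show False using vanish[of a] less_imp_neq[OF \<open>i < j\<close>] u by (auto simp: a)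
qed

lemma amenable_up_imp_singleton:
  fixes \<phi> :: "'a::complex_banach_algebra \<Rightarrow> complex"
  assumes \<phi>: "\<phi> \<in> character_space" and am: "amenable TYPE(('i::linorder, 'a) up)"
  shows "\<exists>i::'i. UNIV = {i}"
proof (rule ccontr)
  assume no: "\<not> (\<exists>i::'i. UNIV = {i})"
  note fin = amenable_up_imp_finite[OF \<phi> am]
  define i :: 'i where "i = Min UNIV"
  define j where "j = Min {k. i < k}"
  have "i \<le> k" for k unfolding i_def using fin by simp
  with no have "{k. i < k} \<noteq> {}" by (metis (mono_tags) Collect_empty_eq UNIV_eq_I le_less singletonI)
  moreover have "finite {k. i < k}" using fin by (rule finite_subset[rotated]) simp
  ultimately have j: "i < j" "\<And>k. i < k \<Longrightarrow> j \<le> k"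
    using Min_in[of "{k. i < k}"] by (auto simp: j_def)
  show False using amenable_up_no_adjacent[OF \<phi> am j(1)] j(2) by force
qed

lemma amenable_up_singleton_iff:
  fixes i :: "'i::linorder"
  assumes single: "(UNIV :: 'i set) = {i}"
  shows "amenable TYPE(('i, 'a::complex_banach_algebra) up) \<longleftrightarrow> amenable TYPE('a)"
proof -
  have all_i: "p = i" for p :: 'i using single by blast
  define \<iota> :: "'a \<Rightarrow> ('i, 'a) up" where "\<iota> x = Abs_up (\<lambda>_ _. x)" for x
  have fin: "finite (UNIV :: ('i \<times> 'i) set)" unfolding finite_prod single by simp
  have \<iota>: "entry (\<iota> x) p q = x" for x p q
  proof -
    have "p \<le> q" for p q :: 'i using all_i[of p] all_i[of q] by simp
    moreover have "finite {(p :: 'i, q :: 'i). x \<noteq> 0}" by (rule finite_subset[OF subset_UNIV fin])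
    ultimately obtain a :: "('i, 'a) up" where "entry a = (\<lambda>_ _. x)"
      using exists_up_finite_support[of "\<lambda>(_::'i) (_::'i). x"] by blast
    then show ?thesis unfolding \<iota>_def by (metis entry_inverse)
  qed
  have \<iota>_entry: "\<iota> (entry a i i) = a" for a
    by (rule up_eqI) (metis \<iota> all_i)
  have norm_\<iota>: "norm (\<iota> x) = norm x" for x
  proof -
    have "(UNIV :: ('i \<times> 'i) set) = {(i, i)}" using all_i by auto
    then have "norm (\<iota> x) = (\<Sum>\<^sub>\<infinity>(p, q)\<in>{(i, i)}. norm (entry (\<iota> x) p q))"
      by (simp only: norm_up_def)
    then show ?thesis by (simp add: \<iota>)
  qed
  have "amenable TYPE('a)" if am: "amenable TYPE(('i, 'a) up)"
  proof (rule amenable_surjective_hom[OF am, of "\<lambda>a. entry a i i"])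
    show "surj (\<lambda>a :: ('i, 'a) up. entry a i i)" by (rule surjI[of _ \<iota>]) (rule \<iota>)
  qed (simp_all add: plus_up.rep_eq scaleC_up.rep_eq entry_mult_diagonal entry_norm_le)
  moreover have "amenable TYPE(('i, 'a) up)" if am: "amenable TYPE('a)"
  proof (rule amenable_surjective_hom[OF am, of \<iota>])
    show "surj \<iota>" by (rule surjI[of _ "\<lambda>a. entry a i i"]) (rule \<iota>_entry)
    show "\<iota> (x * y) = \<iota> x * \<iota> y" for x y
      using \<iota>_entry[of "\<iota> x * \<iota> y"] by (simp add: entry_mult_diagonal \<iota>)
  qed (auto intro!: up_eqI simp: \<iota> norm_\<iota> plus_up.rep_eq scaleC_up.rep_eq)
  ultimately show ?thesis by blast
qed

section \<open>Characterization of amenability\<close>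

theorem theorem2p3:
  assumes "(character_space :: ('a::complex_banach_algebra \<Rightarrow> complex) set) \<noteq> {}"
  shows "amenable TYPE(('i::linorder, 'a) up) \<longleftrightarrow> (\<exists>i::'i. UNIV = {i}) \<and> amenable TYPE('a)"
proof -
  obtain \<phi> :: "'a \<Rightarrow> complex" where "\<phi> \<in> character_space" using assms by blast
  then show ?thesis
    using amenable_up_imp_singleton[of \<phi>, where 'i = 'i]
      amenable_up_singleton_iff[where 'i = 'i and 'a = 'a] by blast
qed

end
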